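(* Let $\Omega\subset\mathbb{C}^n$ be a complete circular and bounded homogeneous domain. Then for every $X\in\mathbb{C}^n$ with $X\neq 0$, $$i\partial\bar\partial\log K_p(0;X) > B_p(0;X)^2\quad\text{for all } p>2,$$ and $$i\partial\bar\partial\log K_p(0;X) < B_p(0;X)^2\quad\text{for all } 0<p<2.$$
   Context: A complete circular and bounded homogeneous domain is a bounded domain $\Omega\subset\mathbb{C}^n$ which is complete circular, i.e. $tz\in\Omega$ for all $z\in\Omega$ and all $t\in\mathbb{C}$ with $|t|\le 1$ (so $0\in\Omega$), and homogeneous, i.e. the group of biholomorphic automorphisms of $\Omega$ acts transitively on $\Omega$. For $p>0$, $A^p(\Omega)$ is the space of holomorphic functions $f$ on $\Omega$ with $\|f\|_p=(\int_\Omega |f|^p)^{1/p}<\infty$ (Lebesgue measure). The $p$-Bergman kernel is $$K_p(z)=\sup_{f\in A^p(\Omega)\setminus\{0\}}\frac{|f(z)|^p}{\|f\|_p^p}.$$ For $X=(X_1,\dots,X_n)\in\mathbb{C}^n$ write $Xf(z)=\sum_j X_j\,\frac{\partial f}{\partial z_j}(z)$. The $p$-Bergman metric is $$B_p(z;X)=K_p(z)^{-1/p}\cdot\sup\left\{\frac{|Xf(z)|}{\|f\|_p}: f\in A^p(\Omega),\ f(z)=0,\ \|f\|_p>0\right\}.$$ For a real-valued function $u$ on $\Omega$, $i\partial\bar\partial u(z;X)$ denotes the (generalized) Levi form $$i\partial\bar\partial u(z;X)=\liminf_{r\to0^+}\frac{1}{r^2}\left\{\frac{1}{2\pi}\int_0^{2\pi}u(z+re^{i\theta}X)\,d\theta-u(z)\right\},$$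 which equals $\sum_{j,k}\frac{\partial^2u}{\partial z_j\partial\bar z_k}(z)X_j\overline{X_k}$ when $u$ is of class $C^2$ near $z$. Here $i\partial\bar\partial\log K_p(z;X)$ means this form for $u=\log K_p$. *)

theory Defs
  imports "HOL-Complex_Analysis.Complex_Analysis"
begin

text \<open>
  Functions on \<open>\<Omega> \<subseteq> \<complex>\<^sup>n\<close> are total functions on \<open>complex ^ 'n\<close>; none of the notions below
  depends on their values outside the open set \<open>\<Omega>\<close>.
\<close>

text \<open>Holomorphic on an open set: the real Frechet derivative exists and is complex linear.\<close>

definition holo_on :: "(complex ^ 'n \<Rightarrow> complex) \<Rightarrow> (complex ^ 'n) set \<Rightarrow> bool" where
  "holo_on f \<Omega> \<longleftrightarrow>
     (\<forall>z\<in>\<Omega>. \<exists>D. (f has_derivative D) (at z) \<and> (\<forall>c v. D (c *s v) = c * D v))"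

definition holo_map_on :: "(complex ^ 'n \<Rightarrow> complex ^ 'm) \<Rightarrow> (complex ^ 'n) set \<Rightarrow> bool" where
  "holo_map_on F \<Omega> \<longleftrightarrow> (\<forall>i. holo_on (\<lambda>z. F z $ i) \<Omega>)"

definition biholo_aut :: "(complex ^ 'n) set \<Rightarrow> (complex ^ 'n \<Rightarrow> complex ^ 'n) \<Rightarrow> bool" where
  "biholo_aut \<Omega> \<phi> \<longleftrightarrow>
     bij_betw \<phi> \<Omega> \<Omega> \<and> holo_map_on \<phi> \<Omega> \<and> holo_map_on (inv_into \<Omega> \<phi>) \<Omega>"

definition homogeneous_dom :: "(complex ^ 'n) set \<Rightarrow> bool" where
  "homogeneous_dom \<Omega> \<longleftrightarrow> (\<forall>a\<in>\<Omega>. \<forall>b\<in>\<Omega>. \<exists>\<phi>. biholo_aut \<Omega> \<phi> \<and> \<phi> a = b)"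

definition complete_circular :: "(complex ^ 'n) set \<Rightarrow> bool" where
  "complete_circular \<Omega> \<longleftrightarrow> (\<forall>z\<in>\<Omega>. \<forall>t::complex. cmod t \<le> 1 \<longrightarrow> t *s z \<in> \<Omega>)"

definition bounded_domain :: "(complex ^ 'n) set \<Rightarrow> bool" where
  "bounded_domain \<Omega> \<longleftrightarrow> open \<Omega> \<and> connected \<Omega> \<and> \<Omega> \<noteq> {} \<and> bounded \<Omega>"

definition A_space :: "real \<Rightarrow> (complex ^ 'n) set \<Rightarrow> (complex ^ 'n \<Rightarrow> complex) set" where
  "A_space p \<Omega> =
     {f. holo_on f \<Omega> \<and> set_integrable lborel \<Omega> (\<lambda>z. cmod (f z) powr p)}"

definition p_norm :: "real \<Rightarrow> (complex ^ 'n) set \<Rightarrow> (complex ^ 'n \<Rightarrow> complex) \<Rightarrow> real" where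
  "p_norm p \<Omega> f = (set_lebesgue_integral lborel \<Omega> (\<lambda>z. cmod (f z) powr p)) powr (1 / p)"

text \<open>
  The suprema below are suprema of sets of reals. For a bounded domain \<open>\<Omega>\<close>, \<open>p > 0\<close> and
  \<open>z \<in> \<Omega>\<close> these sets are nonempty (constants and affine functions lie in \<open>A_space p \<Omega>\<close>)
  and bounded above (mean value and Cauchy estimates), so \<open>Sup\<close> is the true supremum.
  A function is the zero element of \<open>A_space p \<Omega>\<close> if it vanishes on \<open>\<Omega>\<close>.
\<close>

definition p_bergman_kernel :: "real \<Rightarrow> (complex ^ 'n) set \<Rightarrow> complex ^ 'n \<Rightarrow> real" where
  "p_bergman_kernel p \<Omega> z =
     Sup {cmod (f z) powr p / p_norm p \<Omega> f powr p | f. f \<in> A_space p \<Omega> \<and> (\<exists>w\<in>\<Omega>. f w \<noteq> 0)}"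

definition partial_z :: "'n \<Rightarrow> (complex ^ 'n \<Rightarrow> complex) \<Rightarrow> complex ^ 'n \<Rightarrow> complex" where
  "partial_z j f z = deriv (\<lambda>w. f (\<chi> k. if k = j then w else z $ k)) (z $ j)"

definition dir_deriv :: "complex ^ 'n \<Rightarrow> (complex ^ 'n \<Rightarrow> complex) \<Rightarrow> complex ^ 'n \<Rightarrow> complex" where
  "dir_deriv X f z = (\<Sum>j\<in>UNIV. X $ j * partial_z j f z)"

definition p_bergman_metric ::
    "real \<Rightarrow> (complex ^ 'n) set \<Rightarrow> complex ^ 'n \<Rightarrow> complex ^ 'n \<Rightarrow> real" where
  "p_bergman_metric p \<Omega> z X =
     p_bergman_kernel p \<Omega> z powr (- 1 / p) *
     Sup {cmod (dir_deriv X f z) / p_norm p \<Omega> f | f.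
            f \<in> A_space p \<Omega> \<and> f z = 0 \<and> p_norm p \<Omega> f > 0}"

text \<open>The lower limit may a priori be infinite, hence the extended reals.\<close>

definition levi_form :: "(complex ^ 'n \<Rightarrow> real) \<Rightarrow> complex ^ 'n \<Rightarrow> complex ^ 'n \<Rightarrow> ereal" where
  "levi_form u z X =
     Liminf (at_right 0) (\<lambda>r::real. ereal (1 / r\<^sup>2 *
       (1 / (2 * pi) * (LBINT \<theta>:{0..2*pi}. u (z + (of_real r * exp (\<i> * of_real \<theta>)) *s X)) - u z)))"

end

theory Submission
  imports Defs
begin

text \<open>
  Write \<open>V\<close> for the volume of \<open>\<Omega>\<close>. Averaging over circles gives \<open>K\<^sub>p(0) = 1 / V\<close> for every
  \<open>p\<close>. If \<open>\<phi>\<close> is an automorphism with Jacobian \<open>J\<close>, then \<open>f \<mapsto> (f \<circ> \<phi>) J\<^bsup>2/p\<^esup>\<close> is an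
  isometry of \<open>A\<^sup>p(\<Omega>)\<close> (a branch exists, \<open>\<Omega>\<close> being starlike), so
  \<open>K\<^sub>p(z) = |J(z)|\<^sup>2 / V\<close> as soon as \<open>\<phi> z = 0\<close>. By homogeneity \<open>K\<^sub>p = K\<^sub>2\<close>, and the Levi form of
  \<open>log K\<^sub>2\<close> at the origin is \<open>B\<^sub>2(0;X)\<^sup>2\<close>: splitting \<open>f \<in> A\<^sup>2(\<Omega>)\<close> orthogonally into its constant
  part, its linear part and a remainder yields
  \<open>V K\<^sub>2(rX) = 1 + r\<^sup>2 B\<^sub>2(0;X)\<^sup>2 + O(r\<^sup>4)\<close>. The sub-mean value property of \<open>|f(lz) / l|\<^sup>p\<close> in \<open>l\<close>
  shows that only linear forms matter in \<open>B\<^sub>p(0;X)\<close>, which is therefore the maximum of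
  \<open>|a(X)| / M\<^sub>p(a)\<close> over linear forms \<open>a\<close>, where \<open>M\<^sub>p(a)\<close> is the \<open>p\<close>-th power mean of \<open>|a|\<close>
  on \<open>\<Omega>\<close>. Power means are strictly increasing in \<open>p\<close>, hence \<open>B\<^sub>p(0;X)\<close> is strictly decreasing.
\<close>

text \<open>The Levi form of log K_p is computed without differentiating the kernel. As K_p(cz) =
  K_p(z) for |c| = 1, the circle average in \<open>levi_form\<close> is just log K_p(rX), and
  squeezing V K_p(rX) between 1 + r^2 B^2 and 1 + r^2 B^2 + O(r^4), where B = B_2(0;X), turns the
  lower limit into a limit. The error has order r^4 because the remainder, O(r^2) at rX, is
  orthogonal to the constant and linear parts and so enters only through its square.

  The obstacle in the transformation rule is the identity |det_R A| = |det_C A|^2 between the real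
  determinant of size 2n and the complex one. No block computation is made: both sides are
  nonnegative multiplicative functions of A with the same value on scalar matrices, and elimination
  shows that such a function is unique.

  Since A^p is not a normed space for p < 1, the work is done by the sub-mean value inequality for
  |g|^p, valid for every p > 0, and by compactness of the unit sphere of linear forms: a strict
  inequality of means survives because the supremum in B_p is attained.\<close>

no_notation fps_nth (infixl "$" 75)

subsection \<open>Holomorphic functions of several variables\<close>

abbreviation fderiv :: "(complex ^ 'n \<Rightarrow> complex) \<Rightarrow> complex ^ 'n \<Rightarrow> complex ^ 'n \<Rightarrow> complex" where
  "fderiv f z \<equiv> frechet_derivative f (at z)"

lemma norm_vector_scalar_mult: "norm (c *s (v :: complex ^ 'n)) = cmod c * norm v"
  by (simp add: norm_vec_def norm_mult L2_set_right_distrib)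

lemma scaleR_eq_vector_scalar_mult: "r *\<^sub>R (v :: complex ^ 'n) = of_real r *s v"
  unfolding vec_eq_iff vector_scaleR_component vector_smult_component by (simp add: scaleR_conv_of_real)

lemma bounded_linear_vector_scalar_mult_right: "bounded_linear (\<lambda>v :: complex ^ 'n. c *s v)"
  by (rule bounded_linear_intro[where K = "cmod c"])
    (auto simp: norm_vector_scalar_mult vec_eq_iff algebra_simps)

lemma bounded_linear_vector_scalar_mult_left: "bounded_linear (\<lambda>c. c *s (v :: complex ^ 'n))"
  by (rule bounded_linear_intro[where K = "norm v"])
    (auto simp: norm_vector_scalar_mult vec_eq_iff algebra_simps)

lemma continuous_on_vector_scalar_mult [continuous_intros]:
  fixes g :: "'a::topological_space \<Rightarrow> complex ^ 'n"
  assumes "continuous_on S a" "continuous_on S g"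
  shows "continuous_on S (\<lambda>x. a x *s g x)"
  unfolding vector_scalar_mult_def by (intro continuous_intros assms)

lemma has_derivative_imp_fderiv:
  "(f has_derivative D) (at z) \<Longrightarrow> fderiv f z = D"
  using frechet_derivative_at by metis

lemma holo_onI:
  assumes "\<And>z. z \<in> \<Omega> \<Longrightarrow> (f has_derivative D z) (at z)"
    and "\<And>z c v. z \<in> \<Omega> \<Longrightarrow> D z (c *s v) = c * D z v"
  shows "holo_on f \<Omega>"
  unfolding holo_on_def using assms by blast

lemma holo_on_has_derivative:
  "holo_on f \<Omega> \<Longrightarrow> z \<in> \<Omega> \<Longrightarrow> (f has_derivative fderiv f z) (at z)"
  unfolding holo_on_def using has_derivative_imp_fderiv by metis

lemma holo_on_fderiv_scale:
  "holo_on f \<Omega> \<Longrightarrow> z \<in> \<Omega> \<Longrightarrow> fderiv f z (c *s v) = c * fderiv f z v"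
  unfolding holo_on_def using has_derivative_imp_fderiv by metis

lemma holo_on_subset: "holo_on f \<Omega> \<Longrightarrow> U \<subseteq> \<Omega> \<Longrightarrow> holo_on f U"
  unfolding holo_on_def by blast

lemma holo_on_imp_continuous_on: "holo_on f \<Omega> \<Longrightarrow> continuous_on \<Omega> f"
  by (meson continuous_at_imp_continuous_on has_derivative_continuous holo_on_has_derivative)

lemma holo_on_const: "holo_on (\<lambda>z. c) \<Omega>"
  by (rule holo_onI[where D = "\<lambda>_ _. 0"]) auto

lemma holo_on_component: "holo_on (\<lambda>z. z $ i) \<Omega>"
  by (rule holo_onI[where D = "\<lambda>_ v. v $ i"])
    (auto intro!: bounded_linear_imp_has_derivative bounded_linear_vec_nth)

lemma holo_on_add: "holo_on f \<Omega> \<Longrightarrow> holo_on g \<Omega> \<Longrightarrow> holo_on (\<lambda>z. f z + g z) \<Omega>"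
  by (rule holo_onI[where D = "\<lambda>z v. fderiv f z v + fderiv g z v"])
    (auto intro!: has_derivative_add simp: holo_on_has_derivative holo_on_fderiv_scale algebra_simps)

lemma holo_on_mult: "holo_on f \<Omega> \<Longrightarrow> holo_on g \<Omega> \<Longrightarrow> holo_on (\<lambda>z. f z * g z) \<Omega>"
  by (rule holo_onI[where D = "\<lambda>z v. f z * fderiv g z v + fderiv f z v * g z"])
    (auto intro!: has_derivative_mult holo_on_has_derivative, simp add: holo_on_fderiv_scale algebra_simps)

lemma holo_on_diff: "holo_on f \<Omega> \<Longrightarrow> holo_on g \<Omega> \<Longrightarrow> holo_on (\<lambda>z. f z - g z) \<Omega>"
  using holo_on_add[OF _ holo_on_mult[OF holo_on_const[of "-1"]], of f \<Omega> g] by simp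

lemma holo_on_sum: "(\<And>i. i \<in> I \<Longrightarrow> holo_on (f i) \<Omega>) \<Longrightarrow> holo_on (\<lambda>z. \<Sum>i\<in>I. f i z) \<Omega>"
  by (induction I rule: infinite_finite_induct) (auto intro: holo_on_const holo_on_add)

lemma holo_on_prod: "(\<And>i. i \<in> I \<Longrightarrow> holo_on (f i) \<Omega>) \<Longrightarrow> holo_on (\<lambda>z. \<Prod>i\<in>I. f i z) \<Omega>"
  by (induction I rule: infinite_finite_induct) (auto intro: holo_on_const holo_on_mult)

lemma holo_on_compose_field:
  assumes "holo_on f \<Omega>" and "\<And>z. z \<in> \<Omega> \<Longrightarrow> g field_differentiable at (f z)"
  shows "holo_on (\<lambda>z. g (f z)) \<Omega>"
proof (rule holo_onI[where D = "\<lambda>z v. deriv g (f z) * fderiv f z v"])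
  fix z assume z: "z \<in> \<Omega>"
  have "(g has_derivative (\<lambda>h. deriv g (f z) * h)) (at (f z))"
    using assms(2)[OF z] by (simp add: field_differentiable_derivI has_field_derivative_imp_has_derivative)
  from diff_chain_at[OF holo_on_has_derivative[OF assms(1) z] this]
  show "((\<lambda>z. g (f z)) has_derivative (\<lambda>v. deriv g (f z) * fderiv f z v)) (at z)"
    by (simp add: o_def)
qed (use assms in \<open>auto simp: holo_on_fderiv_scale\<close>)

section \<open>Complex Jacobian matrices and the chain rule\<close>

definition jac :: "(complex ^ 'n \<Rightarrow> complex ^ 'm) \<Rightarrow> complex ^ 'n \<Rightarrow> complex ^ 'n ^ 'm" where
  "jac F z = (\<chi> i j. fderiv (\<lambda>z. F z $ i) z (axis j 1))"

lemma fderiv_eq_sum: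
  assumes "holo_on f \<Omega>" "z \<in> \<Omega>"
  shows "fderiv f z v = (\<Sum>j\<in>UNIV. v $ j * fderiv f z (axis j 1))"
proof -
  interpret linear "fderiv f z"
    using holo_on_has_derivative[OF assms] has_derivative_linear by blast
  have "fderiv f z v = fderiv f z (\<Sum>j\<in>UNIV. v $ j *s axis j 1)"
    by (simp add: basis_expansion)
  then show ?thesis
    by (simp add: sum holo_on_fderiv_scale[OF assms])
qed

lemma holo_map_on_has_derivative:
  fixes F :: "complex ^ 'n \<Rightarrow> complex ^ 'm"
  assumes "holo_map_on F \<Omega>" "z \<in> \<Omega>"
  shows "(F has_derivative (*v) (jac F z)) (at z)"
proof -
  have F: "holo_on (\<lambda>z. F z $ i) \<Omega>" for i
    using assms by (simp add: holo_map_on_def)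
  have ax: "bounded_linear (axis i :: complex \<Rightarrow> complex ^ 'm)" for i
    by (rule linear_conv_bounded_linear[THEN iffD1], rule linearI) (auto simp: axis_def vec_eq_iff)
  have eq: "(\<Sum>i\<in>UNIV. axis i (x $ i)) = x" for x :: "complex ^ 'm"
    by (simp add: vec_eq_iff axis_def sum.delta')
  have "((\<lambda>z. \<Sum>i\<in>UNIV. axis i (F z $ i)) has_derivative
      (\<lambda>v. \<Sum>i\<in>UNIV. axis i (fderiv (\<lambda>z. F z $ i) z v))) (at z)"
    by (intro has_derivative_sum bounded_linear.has_derivative[OF ax] holo_on_has_derivative[OF F assms(2)])
  also have "(\<lambda>v. \<Sum>i\<in>UNIV. axis i (fderiv (\<lambda>z. F z $ i) z v)) = (*v) (jac F z)"
    by (rule ext, subst fderiv_eq_sum[OF F assms(2)]) (simp add: vec_eq_iff axis_def sum.delta' matrix_vector_mult_def jac_def mult.commute)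
  finally show ?thesis
    by (simp add: eq)
qed

lemma jac_unique:
  assumes "holo_map_on F \<Omega>" "z \<in> \<Omega>" "(F has_derivative (*v) A) (at z)"
  shows "jac F z = A"
proof -
  have "(*v) (jac F z) = (*v) A"
    using has_derivative_unique[OF holo_map_on_has_derivative[OF assms(1,2)] assms(3)] .
  then show ?thesis
    by (metis matrix_of_matrix_vector_mul matrix_eq)
qed

lemma holo_map_on_imp_continuous_on: "holo_map_on F \<Omega> \<Longrightarrow> continuous_on \<Omega> F"
  by (meson continuous_at_imp_continuous_on has_derivative_continuous holo_map_on_has_derivative)

lemma matrix_vector_mult_smult: "A *v (c *s v) = c *s (A *v (v :: complex ^ 'n))"
  by (simp add: vec_eq_iff matrix_vector_mult_def sum_distrib_left algebra_simps)

lemma holo_on_compose_map: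
  assumes "holo_map_on F U" "holo_on f \<Omega>" "F ` U \<subseteq> \<Omega>"
  shows "holo_on (\<lambda>z. f (F z)) U"
proof (rule holo_onI[where D = "\<lambda>z v. fderiv f (F z) (jac F z *v v)"])
  fix z assume z: "z \<in> U"
  from diff_chain_at[OF holo_map_on_has_derivative[OF assms(1) z] holo_on_has_derivative[OF assms(2)]] z assms(3)
  show "((\<lambda>z. f (F z)) has_derivative (\<lambda>v. fderiv f (F z) (jac F z *v v))) (at z)"
    by (auto simp: o_def)
qed (use assms in \<open>auto simp: matrix_vector_mult_smult holo_on_fderiv_scale[OF assms(2)]\<close>)

section \<open>Restriction to complex lines and Cauchy's formula\<close>

lemma holo_on_line:
  assumes "holo_on f \<Omega>" "z + l *s v \<in> \<Omega>"
  shows "((\<lambda>l. f (z + l *s v)) has_field_derivative fderiv f (z + l *s v) v) (at l)"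
proof -
  have "((\<lambda>l. z + l *s v) has_derivative (\<lambda>h. h *s v)) (at l)"
    by (auto intro!: derivative_eq_intros bounded_linear_imp_has_derivative bounded_linear_vector_scalar_mult_left)
  from diff_chain_at[OF this holo_on_has_derivative[OF assms]]
  show ?thesis
    unfolding has_field_derivative_def o_def holo_on_fderiv_scale[OF assms]
    by (subst (asm) mult.commute)
qed

text \<open>Cauchy's formula for the first derivative of f on the complex line through z in
  direction v. The circle is written out over the fixed interval [0, 1], so that z occurs only in
  the integrand and the formula can be differentiated in z.\<close>

lemma fderiv_eq_integral:
  assumes f: "holo_on f \<Omega>" and r: "r > 0" and sub: "\<And>l. cmod l \<le> r \<Longrightarrow> z + l *s v \<in> \<Omega>"
  shows "fderiv f z v = integral (cbox 0 1)
    (\<lambda>t::real. f (z + (of_real r * exp (2 * of_real pi * \<i> * of_real t)) *s v) / (of_real r * exp (2 * of_real pi * \<i> * of_real t)))"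
proof -
  let ?g = "\<lambda>l. f (z + l *s v)"
  have d: "(?g has_field_derivative fderiv f (z + l *s v) v) (at l)" if "cmod l \<le> r" for l
    using holo_on_line[OF f sub[OF that]] .
  have 1: "continuous_on (cball 0 r) ?g"
    by (intro continuous_at_imp_continuous_on ballI DERIV_isCont[OF d]) auto
  have 2: "?g holomorphic_on ball 0 r"
    by (rule holomorphic_onI, rule field_differentiable_at_within)
      (auto simp: field_differentiable_def intro!: exI d)
  note Cauchy_has_contour_integral_higher_derivative_circlepath[OF 1 2, of 0 1]
  moreover have "deriv ?g 0 = fderiv f z v"
    using DERIV_imp_deriv[OF d[of 0]] r by simp
  ultimately have "((\<lambda>u. ?g u / u\<^sup>2) has_contour_integral 2 * of_real pi * \<i> * fderiv f z v) (circlepath 0 r)"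
    using r by (simp add: power2_eq_square)
  then have "((\<lambda>t. (1 / (2 * of_real pi * \<i>)) * (?g (circlepath 0 r t) / circlepath 0 r t ^ 2 * vector_derivative (circlepath 0 r) (at t)))
     has_integral (1 / (2 * of_real pi * \<i>)) * (2 * of_real pi * \<i> * fderiv f z v)) {0..1}"
    unfolding has_contour_integral by (rule has_integral_mult_right)
  moreover have "(1 / (2 * of_real pi * \<i>)) * (?g (circlepath 0 r t) / circlepath 0 r t ^ 2 * vector_derivative (circlepath 0 r) (at t))
      = f (z + (of_real r * exp (2 * of_real pi * \<i> * of_real t)) *s v) / (of_real r * exp (2 * of_real pi * \<i> * of_real t))" for t
    unfolding vector_derivative_circlepath using r
    by (simp add: circlepath power2_eq_square field_simps)
  ultimately show ?thesis
    by (simp add: integral_unique)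
qed

lemma ball_line_subset:
  assumes "dist z w < e" "cmod l * norm v < d"
  shows "dist z (w + l *s v) < e + d"
proof -
  have "dist z (w + l *s v) \<le> dist z w + dist w (w + l *s v)"
    by (rule dist_triangle)
  also have "dist w (w + l *s v) = cmod l * norm v"
    by (simp add: dist_norm norm_vector_scalar_mult)
  finally show ?thesis using assms by linarith
qed

text \<open>A single radius has to serve a whole ball of centres before the Cauchy integral can be
  studied as a function of z.\<close>

lemma fderiv_local_integral:
  assumes f: "holo_on f \<Omega>" and "open \<Omega>" "z0 \<in> \<Omega>"
  obtains e r where "e > 0" "r > 0" "ball z0 e \<subseteq> \<Omega>"
    "\<forall>z\<in>ball z0 e. \<forall>l. cmod l \<le> r \<longrightarrow> z + l *s v \<in> \<Omega>"
    "\<forall>z\<in>ball z0 e. fderiv f z v = integral (cbox 0 1)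
    (\<lambda>t::real. f (z + (of_real r * exp (2 * of_real pi * \<i> * of_real t)) *s v) / (of_real r * exp (2 * of_real pi * \<i> * of_real t)))"
proof -
  obtain d where d: "d > 0" "ball z0 d \<subseteq> \<Omega>"
    using assms open_contains_ball by blast
  \<comment> \<open>The summand 1 covers v = 0. Centres within d / 2 of z0 and displacements below d
    / 2 stay inside \<open>ball z0 d\<close>.\<close>
  define r where "r = d / 4 / (norm v + 1)"
  have r: "r > 0" "r * norm v < d / 2"
    using d by (auto simp: r_def field_simps add_pos_nonneg)
  have in\<Omega>: "z + l *s v \<in> \<Omega>" if "z \<in> ball z0 (d/2)" "cmod l \<le> r" for z l
  proof -
    have "cmod l * norm v < d / 2"
      using that(2) r(2) by (meson mult_right_mono norm_ge_zero order.strict_trans1)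
    then have "dist z0 (z + l *s v) < d / 2 + d / 2"
      using that by (intro ball_line_subset) auto
    then show ?thesis using d by auto
  qed
  show ?thesis
  proof (rule that[of "d/2" r])
    show "\<forall>z\<in>ball z0 (d/2). fderiv f z v = integral (cbox 0 1)
    (\<lambda>t::real. f (z + (of_real r * exp (2 * of_real pi * \<i> * of_real t)) *s v) / (of_real r * exp (2 * of_real pi * \<i> * of_real t)))"
      using fderiv_eq_integral[OF f r(1) in\<Omega>] by blast
  qed (use d r in\<Omega> in auto)
qed

text \<open>Continuity of the derivative precedes its differentiability: differentiation under the
  integral sign in \<open>holo_on_fderiv\<close> asks for an integrand whose derivative is
  continuous.\<close>

lemma fderiv_continuous_on:
  assumes f: "holo_on f \<Omega>" and "open \<Omega>"
  shows "continuous_on \<Omega> (\<lambda>z. fderiv f z v)"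
proof (intro continuous_at_imp_continuous_on ballI)
  fix z0 assume "z0 \<in> \<Omega>"
  obtain e r where er: "e > 0" "r > 0" "ball z0 e \<subseteq> \<Omega>"
    "\<forall>z\<in>ball z0 e. \<forall>l. cmod l \<le> r \<longrightarrow> z + l *s v \<in> \<Omega>"
    "\<forall>z\<in>ball z0 e. fderiv f z v = integral (cbox 0 1)
    (\<lambda>t::real. f (z + (of_real r * exp (2 * of_real pi * \<i> * of_real t)) *s v) / (of_real r * exp (2 * of_real pi * \<i> * of_real t)))"
    by (rule fderiv_local_integral[OF assms \<open>z0 \<in> \<Omega>\<close>, where v = v])
  have "continuous_on (ball z0 e) (\<lambda>z. integral (cbox 0 1)
    (\<lambda>t::real. f (z + (of_real r * exp (2 * of_real pi * \<i> * of_real t)) *s v) / (of_real r * exp (2 * of_real pi * \<i> * of_real t))))"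
    unfolding split_beta
    by (intro integral_continuous_on_param)
      (use er(2,4) in \<open>auto simp: split_beta norm_mult intro!: continuous_intros
        continuous_on_compose2[OF holo_on_imp_continuous_on[OF f]]\<close>)
  then have "continuous_on (ball z0 e) (\<lambda>z. fderiv f z v)"
    by (rule continuous_on_eq) (simp add: er(5))
  then show "isCont (\<lambda>z. fderiv f z v) z0"
    using er(1) by (simp add: continuous_on_eq_continuous_at)
qed

text \<open>The Cauchy integral is differentiated under the integral sign. This makes the Jacobian
  determinant holomorphic, so that a holomorphic logarithm of it can be taken.\<close>

lemma holo_on_fderiv:
  assumes f: "holo_on f \<Omega>" and \<Omega>: "open \<Omega>"
  shows "holo_on (\<lambda>z. fderiv f z v) \<Omega>"
  unfolding holo_on_def
proof
  fix z0 assume z0: "z0 \<in> \<Omega>"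
  obtain e r where er: "e > 0" "r > 0" "ball z0 e \<subseteq> \<Omega>"
    "\<forall>z\<in>ball z0 e. \<forall>l. cmod l \<le> r \<longrightarrow> z + l *s v \<in> \<Omega>"
    "\<forall>z\<in>ball z0 e. fderiv f z v = integral (cbox 0 1)
    (\<lambda>t::real. f (z + (of_real r * exp (2 * of_real pi * \<i> * of_real t)) *s v) / (of_real r * exp (2 * of_real pi * \<i> * of_real t)))"
    by (rule fderiv_local_integral[OF assms z0, where v = v])
  define c where "c t = of_real r * exp (2 * of_real pi * \<i> * of_real t)" for t :: real
  have c: "cmod (c t) = r" "c t \<noteq> 0" for t
    using er(2) by (auto simp: c_def norm_mult)
  have c_cont: "continuous_on S c" for S
    unfolding c_def by (intro continuous_intros)
  \<comment> \<open>The derivative of the integrand in z, packed as a bounded linear map because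
    \<open>leibniz_rule\<close> integrates such maps.\<close>
  define \<Phi> where "\<Phi> z t = Blinfun (\<lambda>w. fderiv f (z + c t *s v) w / c t)" for z t
  have der: "((\<lambda>z. f (z + c t *s v) / c t) has_derivative (\<lambda>w. fderiv f (z + c t *s v) w / c t)) (at z)"
    if "z \<in> ball z0 e" for z t
  proof -
    have "((\<lambda>z. z + c t *s v) has_derivative (\<lambda>w. w)) (at z)"
      by (auto intro!: derivative_eq_intros)
    from diff_chain_at[OF this holo_on_has_derivative[OF f er(4)[rule_format, OF that]]] c(1)
    have "((\<lambda>z. f (z + c t *s v)) has_derivative (\<lambda>w. fderiv f (z + c t *s v) w)) (at z)"
      by (simp add: o_def)
    from has_derivative_mult_right[OF this, of "inverse (c t)"] show ?thesis
      by (simp add: field_class.field_divide_inverse mult.commute)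
  qed
  have \<Phi>: "blinfun_apply (\<Phi> z t) = (\<lambda>w. fderiv f (z + c t *s v) w / c t)"
    if "z \<in> ball z0 e" for z t
    unfolding \<Phi>_def by (rule bounded_linear_Blinfun_apply[OF has_derivative_bounded_linear[OF der[OF that]]])
  have \<Phi>cont: "continuous_on (ball z0 e \<times> cbox 0 1) (\<lambda>(z, t). \<Phi> z t)"
  proof (rule continuous_on_blinfun_componentwise)
    fix i :: "complex ^ 'a" assume "i \<in> Basis"
    have "continuous_on (ball z0 e \<times> cbox 0 1) (\<lambda>x. fderiv f (fst x + c (snd x) *s v) i / c (snd x))"
      by (intro continuous_intros continuous_on_compose2[OF fderiv_continuous_on[OF assms]]
          continuous_on_compose2[OF c_cont]) (use er(4) c in auto)
    then show "continuous_on (ball z0 e \<times> cbox 0 1) (\<lambda>x. blinfun_apply (case x of (z, t) \<Rightarrow> \<Phi> z t) i)"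
      by (subst continuous_on_cong[OF refl]) (auto simp: \<Phi>)
  qed
  have fcont: "(\<lambda>t. f (z + c t *s v) / c t) integrable_on cbox 0 1" if "z \<in> ball z0 e" for z
    by (intro integrable_continuous continuous_intros c_cont
          continuous_on_compose2[OF holo_on_imp_continuous_on[OF f]]) (use er(4)[rule_format, OF that] c in auto)
  have "((\<lambda>z. integral (cbox 0 1) (\<lambda>t. f (z + c t *s v) / c t)) has_derivative
      blinfun_apply (integral (cbox 0 1) (\<Phi> z0))) (at z0 within ball z0 e)"
    by (rule leibniz_rule[OF _ fcont \<Phi>cont]) (use er(1) der in \<open>auto simp: \<Phi> has_derivative_at_withinI\<close>)
  then have "((\<lambda>z. integral (cbox 0 1) (\<lambda>t. f (z + c t *s v) / c t)) has_derivative
      blinfun_apply (integral (cbox 0 1) (\<Phi> z0))) (at z0)"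
    by (subst (asm) at_within_open) (auto simp: er(1))
  then have 1: "((\<lambda>z. fderiv f z v) has_derivative blinfun_apply (integral (cbox 0 1) (\<Phi> z0))) (at z0)"
    by (rule has_derivative_transform_within_open[where s = "ball z0 e"])
      (use er(1,5) in \<open>auto simp: c_def\<close>)
  have z0e: "z0 \<in> ball z0 e" using er(1) by simp
  have "continuous_on (cbox 0 1) (\<lambda>t. (\<lambda>(z, t). \<Phi> z t) (z0, t))"
    by (rule continuous_on_compose2[OF \<Phi>cont]) (use z0e in \<open>auto intro!: continuous_intros\<close>)
  then have int: "\<Phi> z0 integrable_on cbox 0 1"
    by (intro integrable_continuous) simp
  have app: "blinfun_apply (integral (cbox 0 1) (\<Phi> z0)) w = integral (cbox 0 1) (\<lambda>t. blinfun_apply (\<Phi> z0 t) w)" for w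
    by (rule blinfun_apply_integral[OF int])
  \<comment> \<open>Complex linearity holds for each t and passes through the integral.\<close>
  have 2: "blinfun_apply (integral (cbox 0 1) (\<Phi> z0)) (a *s w) = a * blinfun_apply (integral (cbox 0 1) (\<Phi> z0)) w" for a w
  proof -
    have "fderiv f (z0 + c t *s v) (a *s w) / c t = a * (fderiv f (z0 + c t *s v) w / c t)" for t
      using holo_on_fderiv_scale[OF f er(4)[rule_format, OF z0e]] c(1) by simp
    then show ?thesis
      unfolding app \<Phi>[OF z0e] by (simp only: integral_mult_right)
  qed
  show "\<exists>D. ((\<lambda>z. fderiv f z v) has_derivative D) (at z0) \<and> (\<forall>c v. D (c *s v) = c * D v)"
    using 1 2 by blast
qed

subsection \<open>Complex Jacobians\<close>

lemma holo_on_det_jac: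
  assumes "holo_map_on F \<Omega>" "open \<Omega>"
  shows "holo_on (\<lambda>z. det (jac F z)) \<Omega>"
  unfolding det_def jac_def
  using assms by (auto simp: holo_map_on_def intro!: holo_on_sum holo_on_prod holo_on_mult holo_on_const holo_on_fderiv)

text \<open>Contractibility yields a continuous logarithm g. Near z0 it moves by less than 1 < pi,
  so there it must equal \<open>g z0 + Ln (J z / J z0)\<close>, which is complex differentiable at
  z0.\<close>

lemma holo_on_logarithm:
  fixes J :: "complex ^ 'n \<Rightarrow> complex"
  assumes J: "holo_on J \<Omega>" and "open \<Omega>" "contractible \<Omega>" and nz: "\<And>z. z \<in> \<Omega> \<Longrightarrow> J z \<noteq> 0"
  obtains g where "holo_on g \<Omega>" "\<And>z. z \<in> \<Omega> \<Longrightarrow> J z = exp (g z)"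
proof -
  obtain g where g: "continuous_on \<Omega> g" "\<And>z. z \<in> \<Omega> \<Longrightarrow> J z = exp (g z)"
    using continuous_logarithm_on_contractible[OF holo_on_imp_continuous_on[OF J]] assms by metis
  have "holo_on g \<Omega>"
    unfolding holo_on_def
  proof
    fix z0 assume z0: "z0 \<in> \<Omega>"
    have "isCont g z0"
      using g(1) \<open>open \<Omega>\<close> z0 by (simp add: continuous_on_eq_continuous_at)
    then have "(g \<longlongrightarrow> g z0) (nhds z0)"
      by (simp add: isCont_def tendsto_at_iff_tendsto_nhds)
    then have "\<forall>\<^sub>F z in nhds z0. dist (g z) (g z0) < 1"
      by (rule tendstoD) simp
    moreover have "\<forall>\<^sub>F z in nhds z0. z \<in> \<Omega>"
      using \<open>open \<Omega>\<close> z0 by (rule eventually_nhds_in_open)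
    ultimately have "\<forall>\<^sub>F z in nhds z0. g z0 + Ln (J z / J z0) = g z"
    proof eventually_elim
      case (elim z)
      have "\<bar>Im (g z - g z0)\<bar> < 1"
        using elim(1) abs_Im_le_cmod[of "g z - g z0"] by (simp add: dist_norm)
      then have "Ln (exp (g z - g z0)) = g z - g z0"
        using pi_gt3 by (intro Ln_exp) auto
      then show ?case
        using g(2) z0 elim(2) by (simp add: exp_diff)
    qed
    then obtain U where U: "open U" "z0 \<in> U" "\<And>z. z \<in> U \<Longrightarrow> g z0 + Ln (J z / J z0) = g z"
      unfolding eventually_nhds by blast
    have "holo_on (\<lambda>z. g z0 + Ln (J z * inverse (J z0))) {z0}"
      by (intro holo_on_add holo_on_const holo_on_compose_field[where g = Ln] holo_on_mult
          holo_on_subset[OF J]) (use z0 nz in \<open>auto intro!: field_differentiable_at_Ln\<close>)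
    then obtain D where "((\<lambda>z. g z0 + Ln (J z / J z0)) has_derivative D) (at z0)" "\<And>c v. D (c *s v) = c * D v"
      by (auto simp: holo_on_def field_class.field_divide_inverse)
    then show "\<exists>D. (g has_derivative D) (at z0) \<and> (\<forall>c v. D (c *s v) = c * D v)"
      using has_derivative_transform_within_open[OF _ U(1,2), where g = g] U(3) by blast
  qed
  with g(2) show ?thesis using that by blast
qed

section \<open>Multiplicative functions of complex matrices\<close>

definition diag_mat :: "('n \<Rightarrow> complex) \<Rightarrow> complex ^ 'n ^ 'n" where
  "diag_mat d = (\<chi> i j. if i = j then d i else 0)"

definition swap_mat :: "'n \<Rightarrow> 'n \<Rightarrow> complex ^ 'n ^ 'n" where
  "swap_mat a b = (\<chi> i j. if i = Transposition.transpose a b j then 1 else 0)"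

lemma diag_mat_mult_left: "(diag_mat d ** A) $ i $ j = d i * A $ i $ j"
  by (simp add: matrix_matrix_mult_def diag_mat_def if_distrib[of "\<lambda>x. x * _"] sum.delta cong: if_cong)

lemma diag_mat_mult_right: "(A ** diag_mat d) $ i $ j = A $ i $ j * d j"
  by (simp add: matrix_matrix_mult_def diag_mat_def if_distrib[of "\<lambda>x. _ * x"] sum.delta' cong: if_cong)

lemma swap_mat_mult_right: "(A ** swap_mat a b) $ i $ j = A $ i $ (Transposition.transpose a b j)"
  by (simp add: matrix_matrix_mult_def swap_mat_def if_distrib[of "\<lambda>x. _ * x"] sum.delta' cong: if_cong)

lemma swap_mat_mult_left: "(swap_mat a b ** A) $ i $ j = A $ (Transposition.transpose a b i) $ j"
proof -
  have "(swap_mat a b ** A) $ i $ j = (\<Sum>k\<in>UNIV. if k = Transposition.transpose a b i then A $ k $ j else 0)"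
    unfolding matrix_matrix_mult_def swap_mat_def vec_lambda_beta
    by (rule sum.cong) (auto simp: transpose_eq_iff)
  then show ?thesis by simp
qed

lemma diag_mat_const: "diag_mat (\<lambda>_. c) = mat c"
  by (simp add: diag_mat_def mat_def)

lemma matrix_add_rdistrib: "(A + B) ** C = A ** C + B ** (C :: complex ^ 'n ^ 'n)"
  by (simp add: vec_eq_iff matrix_matrix_mult_def sum.distrib algebra_simps)

text \<open>Properties shared by the squared modulus of the complex determinant and the modulus of
  the real one; the exponent is the real dimension. By \<open>matrix_modulus_unique\<close> they
  determine \<open>F\<close>.\<close>

locale matrix_modulus =
  fixes F :: "complex ^ 'n ^ 'n \<Rightarrow> real"
  assumes nonneg: "F A \<ge> 0"
    and mult: "F (A ** B) = F A * F B"
    and scalar: "F (mat c) = cmod c ^ (2 * CARD('n))"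
begin

lemma F_one: "F (mat 1) = 1"
  using scalar[of 1] by simp

lemma F_swap: "F (swap_mat a b) = 1"
proof -
  have "swap_mat a b ** swap_mat a b = mat 1"
    by (simp only: vec_eq_iff swap_mat_mult_left) (auto simp: swap_mat_def mat_def transpose_eq_iff)
  then have "F (swap_mat a b) * F (swap_mat a b) = 1"
    by (metis mult F_one)
  then show ?thesis
    using nonneg[of "swap_mat a b"] by (simp add: flip: power2_eq_square) (simp add: power2_eq_1_iff)
qed

text \<open>A diagonal matrix is a product of factors with a single nontrivial entry. Factors with
  the same entry in different places are conjugate under swaps, so \<open>F\<close> cannot tell them
  apart; their product over all places is a scalar matrix, and an n-th root gives the value of one
  factor.\<close>

lemma F_diag: "F (diag_mat d) = (\<Prod>i\<in>UNIV. (cmod (d i))\<^sup>2)"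
proof -
  define E where "E c i = diag_mat (\<lambda>k. if k = i then c else 1)" for c :: complex and i :: 'n
  have prod: "F (diag_mat (\<lambda>k. if k \<in> S then d k else 1)) = (\<Prod>i\<in>S. F (E (d i) i))" if "finite S" for S d
    using that
  proof (induction S)
    case empty
    then show ?case by (simp add: diag_mat_const F_one)
  next
    case (insert i S)
    have "diag_mat (\<lambda>k. if k \<in> insert i S then d k else 1) = E (d i) i ** diag_mat (\<lambda>k. if k \<in> S then d k else 1)"
      unfolding vec_eq_iff E_def diag_mat_mult_left using insert by (auto simp: diag_mat_def)
    then show ?case using insert by (simp add: mult)
  qed
  have E: "F (E c i) = (cmod c)\<^sup>2" for c i
  proof -
    have "F (E c j) = F (E c i)" for j
    proof -
      have "E c j = swap_mat i j ** E c i ** swap_mat i j"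
        unfolding vec_eq_iff E_def swap_mat_mult_left swap_mat_mult_right
        by (auto simp: diag_mat_def Transposition.transpose_def)
      then show ?thesis by (simp add: mult F_swap)
    qed
    then have "(\<Prod>j\<in>UNIV. F (E c j)) = F (E c i) ^ CARD('n)"
      unfolding prod_constant[symmetric] by (rule prod.cong[OF refl])
    then have "F (diag_mat (\<lambda>k. if k \<in> UNIV then c else 1)) = F (E c i) ^ CARD('n)"
      using prod[of UNIV "\<lambda>_. c"] by simp
    then have "F (E c i) ^ CARD('n) = ((cmod c)\<^sup>2) ^ CARD('n)"
      by (simp add: diag_mat_const scalar power_mult)
    then show ?thesis
      using nonneg[of "E c i"] power_eq_iff_eq_base[of "CARD('n)" "F (E c i)" "(cmod c)\<^sup>2"] by simp
  qed
  show ?thesis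
    using prod[of UNIV d] by (simp add: E)
qed

text \<open>Conjugation by a diagonal matrix doubles the nilpotent part, while squaring also doubles it.\<close>

lemma F_unipotent:
  fixes N :: "complex ^ 'n ^ 'n"
  assumes "\<And>i j. N $ i $ j = (if (i = a) \<noteq> (j = a) \<and> (i = a \<longleftrightarrow> rw) then v i j else 0)"
  shows "F (mat 1 + N) = 1"
proof -
  define D where "D = diag_mat (\<lambda>k. if k = a \<longleftrightarrow> rw then (2::complex) else 1)"
  have "N $ i $ k * N $ k $ j = 0" for i j k
    by (auto simp: assms)
  then have NN: "N ** N = 0"
    unfolding vec_eq_iff matrix_matrix_mult_def by (auto intro!: sum.neutral simp del: mult_eq_0_iff)
  have "(mat 1 + N) ** (mat 1 + N) = mat 1 + (N + N)"
    by (simp add: matrix_add_ldistrib matrix_add_rdistrib NN)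
  then have sq: "F (mat 1 + (N + N)) = F (mat 1 + N) ^ 2"
    by (metis mult power2_eq_square)
  have "D ** N = (N + N) ** D"
    unfolding vec_eq_iff D_def diag_mat_mult_left diag_mat_mult_right by (auto simp: assms)
  then have "D ** (mat 1 + N) = (mat 1 + (N + N)) ** D"
    by (simp add: matrix_add_ldistrib matrix_add_rdistrib)
  then have "F D * F (mat 1 + N) = F (mat 1 + (N + N)) * F D"
    by (metis mult)
  moreover have "F D \<noteq> 0"
    by (auto simp: D_def F_diag)
  ultimately have "F (mat 1 + N) ^ 2 = F (mat 1 + N)"
    using sq by simp
  moreover have "N $ i $ k * (- N) $ k $ j = 0" for i j k
    by (auto simp: assms)
  then have "N ** (- N) = 0"
    unfolding vec_eq_iff matrix_matrix_mult_def by (auto intro!: sum.neutral simp del: mult_eq_0_iff)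
  then have "(mat 1 + N) ** (mat 1 + (- N)) = mat 1"
    by (simp only: matrix_add_ldistrib matrix_add_rdistrib) simp
  then have "F (mat 1 + N) \<noteq> 0"
    by (metis mult F_one mult_zero_left zero_neq_one)
  ultimately show ?thesis
    by (simp add: power2_eq_square)
qed

end

text \<open>Gaussian elimination. The set \<open>K\<close> collects the indices whose row and column
  already vanish off the diagonal. A column swap and two unipotent factors, on all of which
  \<open>F\<close> and \<open>G\<close> are 1, add a pivot index to \<open>K\<close>; diagonal
  matrices are settled by \<open>F_diag\<close>.\<close>

lemma matrix_modulus_unique:
  fixes F G :: "complex ^ 'n ^ 'n \<Rightarrow> real"
  assumes "matrix_modulus F" "matrix_modulus G"
  shows "F A = G A"
proof -
  interpret F: matrix_modulus F by fact
  interpret G: matrix_modulus G by fact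
  have "F A = G A" if "\<And>i j. i \<in> K \<or> j \<in> K \<Longrightarrow> i \<noteq> j \<Longrightarrow> A $ i $ j = 0" for K A
    using that
  proof (induction "card (- K)" arbitrary: K A rule: less_induct)
    case less
    show ?case
    proof (cases "\<exists>a b. a \<notin> K \<and> b \<notin> K \<and> A $ a $ b \<noteq> 0")
      case False
      then have "A = diag_mat (\<lambda>i. A $ i $ i)"
        using less.prems by (auto simp: vec_eq_iff diag_mat_def)
      then show ?thesis
        by (metis F.F_diag G.F_diag)
    next
      case True
      then obtain a b where ab: "a \<notin> K" "b \<notin> K" "A $ a $ b \<noteq> 0" by blast
      \<comment> \<open>Swapping columns a and b moves the nonzero entry to the place (a, a), where
        it can serve as pivot; as a and b lie outside \<open>K\<close>, the zeros already made are
        kept.\<close>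
      define B where "B = A ** swap_mat a b"
      have B: "B $ i $ j = A $ i $ (Transposition.transpose a b j)" for i j
        by (simp add: B_def swap_mat_mult_right)
      have Baa: "B $ a $ a \<noteq> 0" using ab by (simp add: B)
      have BK: "B $ i $ j = 0" if "i \<in> K \<or> j \<in> K" "i \<noteq> j" for i j
        unfolding B using that ab by (intro less.prems) (auto simp: Transposition.transpose_def)
      \<comment> \<open>Left multiplication by \<open>mat 1 + N\<close> clears column a outside the
        pivot, right multiplication by \<open>mat 1 + M\<close> then clears row a.\<close>
      define N where "N = (\<chi> i j. if j = a \<and> i \<noteq> a then - B $ i $ a / B $ a $ a else 0)"
      define M where "M = (\<chi> i j. if i = a \<and> j \<noteq> a then - B $ a $ j / B $ a $ a else 0)"
      have N1: "F (mat 1 + N) = 1" "G (mat 1 + N) = 1"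
        by (rule F.F_unipotent[where a = a and rw = False and v = "\<lambda>i j. - B $ i $ a / B $ a $ a"]
              G.F_unipotent[where a = a and rw = False and v = "\<lambda>i j. - B $ i $ a / B $ a $ a"], auto simp: N_def)+
      have M1: "F (mat 1 + M) = 1" "G (mat 1 + M) = 1"
        by (rule F.F_unipotent[where a = a and rw = True and v = "\<lambda>i j. - B $ a $ j / B $ a $ a"]
              G.F_unipotent[where a = a and rw = True and v = "\<lambda>i j. - B $ a $ j / B $ a $ a"], auto simp: M_def)+
      define C where "C = (mat 1 + N) ** B ** (mat 1 + M)"
      have NB: "((mat 1 + N) ** B) $ i $ j = B $ i $ j - (if i = a then 0 else B $ i $ a * B $ a $ j / B $ a $ a)" for i j
      proof -
        have "(N ** B) $ i $ j = (\<Sum>k\<in>UNIV. if k = a then (if i = a then 0 else - B $ i $ a * B $ a $ j / B $ a $ a) else 0)"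
          unfolding matrix_matrix_mult_def N_def vec_lambda_beta by (rule sum.cong) auto
        then show ?thesis by (simp add: matrix_add_rdistrib)
      qed
      have C: "C $ i $ j = ((mat 1 + N) ** B) $ i $ j - (if j = a then 0 else ((mat 1 + N) ** B) $ i $ a * B $ a $ j / B $ a $ a)" for i j
      proof -
        have "(H ** M) $ i $ j = (\<Sum>k\<in>UNIV. if k = a then (if j = a then 0 else - H $ i $ a * B $ a $ j / B $ a $ a) else 0)" for H :: "complex ^ 'n ^ 'n"
          unfolding matrix_matrix_mult_def M_def vec_lambda_beta by (rule sum.cong) auto
        then show ?thesis by (simp add: matrix_add_ldistrib C_def)
      qed
      have "F C = G C"
      proof (rule less.hyps)
        show "card (- insert a K) < card (- K)"
          using ab by (intro psubset_card_mono) auto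
        fix i j assume "i \<in> insert a K \<or> j \<in> insert a K" "i \<noteq> j"
        then show "C $ i $ j = 0"
          unfolding C NB using BK ab Baa by auto
      qed
      then show ?thesis
        by (simp add: C_def B_def F.mult G.mult N1 M1 F.F_swap G.F_swap)
    qed
  qed
  from this[of "{}"] show ?thesis by simp
qed

lemma matrix_modulus_det: "matrix_modulus (\<lambda>A :: complex ^ 'n ^ 'n. (cmod (det A))\<^sup>2)"
proof
  fix c :: complex
  have "det (mat c :: complex ^ 'n ^ 'n) = c ^ CARD('n)"
    by (subst det_diagonal) (auto simp: mat_def)
  then show "(cmod (det (mat c :: complex ^ 'n ^ 'n)))\<^sup>2 = cmod c ^ (2 * CARD('n))"
    by (simp add: norm_power power_mult mult.commute)
qed (simp_all add: det_mul norm_mult power_mult_distrib)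

subsection \<open>Change of variables\<close>

lemma has_absolute_integral_change_of_variables_scalar:
  fixes f :: "real^'m::{finite,wellorder} \<Rightarrow> real" and g :: "real^'m::_ \<Rightarrow> real^'m::_"
  assumes "S \<in> sets lebesgue"
    and "\<And>x. x \<in> S \<Longrightarrow> (g has_derivative g' x) (at x within S)"
    and "inj_on g S"
  shows "(\<lambda>x. \<bar>det (matrix (g' x))\<bar> * f (g x)) absolutely_integrable_on S \<and>
           integral S (\<lambda>x. \<bar>det (matrix (g' x))\<bar> * f (g x)) = b
     \<longleftrightarrow> f absolutely_integrable_on (g ` S) \<and> integral (g ` S) f = b"
proof -
  have "(\<lambda>x. \<bar>det (matrix (g' x))\<bar> *\<^sub>R vec (f (g x)) :: real ^ 1) absolutely_integrable_on S \<and>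
           integral S (\<lambda>x. \<bar>det (matrix (g' x))\<bar> *\<^sub>R vec (f (g x))) = (vec b :: real ^ 1)
     \<longleftrightarrow> (\<lambda>x. vec (f x) :: real ^ 1) absolutely_integrable_on (g ` S) \<and> integral (g ` S) (\<lambda>x. vec (f x)) = (vec b :: real ^ 1)"
    by (rule has_absolute_integral_change_of_variables) (use assms in auto)
  then show ?thesis
    by (simp add: absolutely_integrable_on_1_iff integral_on_1_eq)
qed

text \<open>The change of variables theorem of the library needs a well-ordered index type; the type
  \<open>'n bit0\<close> is one, with twice as many elements as \<open>'n\<close>.\<close>

definition cbasis :: "'n::finite bit0 \<Rightarrow> complex ^ 'n" where
  "cbasis = (SOME b. bij_betw b UNIV Basis)"

lemma bij_betw_cbasis: "bij_betw (cbasis :: 'n::finite bit0 \<Rightarrow> complex ^ 'n) UNIV Basis"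
proof -
  have "card (UNIV :: 'n bit0 set) = card (Basis :: (complex ^ 'n) set)"
    by simp
  then have "\<exists>b. bij_betw b (UNIV :: 'n bit0 set) (Basis :: (complex ^ 'n) set)"
    by (intro finite_same_card_bij) auto
  then show ?thesis unfolding cbasis_def by (rule someI_ex)
qed

section \<open>Real coordinates on complex space\<close>

definition to_real :: "complex ^ 'n \<Rightarrow> real ^ 'n::finite bit0" where
  "to_real x = (\<chi> k. x \<bullet> cbasis k)"

definition of_real_vec :: "real ^ 'n::finite bit0 \<Rightarrow> complex ^ 'n" where
  "of_real_vec y = (\<Sum>k\<in>UNIV. (y $ k) *\<^sub>R cbasis k)"

lemma cbasis_in_Basis: "cbasis k \<in> Basis"
  using bij_betw_cbasis by (auto simp: bij_betw_def)

lemma inner_cbasis: "cbasis j \<bullet> cbasis k = (if j = k then 1 else 0)"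
proof -
  have "cbasis j = cbasis k \<longleftrightarrow> j = k"
    using bij_betw_cbasis by (auto simp: bij_betw_def inj_on_def)
  then show ?thesis
    using cbasis_in_Basis[of j] cbasis_in_Basis[of k] by (simp add: inner_Basis)
qed

lemma of_real_vec_inner_cbasis: "of_real_vec y \<bullet> cbasis k = y $ k"
  by (simp add: of_real_vec_def inner_sum_left inner_cbasis if_distrib[of "\<lambda>x. _ * x"] sum.delta' cong: if_cong)

lemma to_of_real_vec [simp]: "to_real (of_real_vec y) = y"
  by (simp add: to_real_def vec_eq_iff of_real_vec_inner_cbasis)

lemma of_to_real_vec [simp]: "of_real_vec (to_real x) = x"
proof -
  have "of_real_vec (to_real x) = (\<Sum>b\<in>Basis. (x \<bullet> b) *\<^sub>R b)"
    unfolding of_real_vec_def to_real_def vec_lambda_beta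
    by (rule sum.reindex_bij_betw[OF bij_betw_cbasis])
  then show ?thesis by (simp add: euclidean_representation)
qed

lemma linear_to_real: "linear to_real"
  by (rule linearI) (auto simp: to_real_def vec_eq_iff inner_add_left)

lemma linear_of_real_vec: "linear of_real_vec"
  by (rule linearI) (auto simp: of_real_vec_def algebra_simps sum.distrib scaleR_sum_right)

lemma norm_of_real_vec: "norm (of_real_vec y) = norm y"
proof -
  have "of_real_vec y \<bullet> of_real_vec y = (\<Sum>k\<in>UNIV. y $ k * (cbasis k \<bullet> of_real_vec y))"
    by (subst (1) of_real_vec_def) (simp add: inner_sum_left)
  also have "\<dots> = y \<bullet> y"
    by (simp add: inner_commute[of "cbasis _"] of_real_vec_inner_cbasis) (simp add: inner_vec_def)
  finally show ?thesis by (simp add: norm_eq_sqrt_inner)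
qed

lemma norm_to_real: "norm (to_real x) = norm x"
  by (metis norm_of_real_vec of_to_real_vec)

lemma continuous_on_of_real_vec: "continuous_on S of_real_vec"
  using linear_continuous_on linear_of_real_vec linear_conv_bounded_linear by blast

text \<open>The coordinate map only relabels an orthonormal basis, so boxes correspond to boxes with
  the same edge lengths, and Lebesgue measure is determined by its values on boxes.\<close>

lemma lborel_distr_of_real_vec:
  "(lborel :: (complex ^ 'n) measure) = distr lborel borel of_real_vec"
proof (rule lborel_eqI)
  fix l u :: "complex ^ 'n"
  assume lu: "\<And>b. b \<in> Basis \<Longrightarrow> l \<bullet> b \<le> u \<bullet> b"
  have m: "of_real_vec \<in> borel_measurable (lborel :: (real ^ 'n bit0) measure)"
    using borel_measurable_continuous_onI[OF continuous_on_of_real_vec] by simp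
  have "x \<in> box l u \<longleftrightarrow> (\<forall>k. l \<bullet> cbasis k < x \<bullet> cbasis k \<and> x \<bullet> cbasis k < u \<bullet> cbasis k)" for x
    using bij_betw_cbasis[where 'n = 'n] unfolding mem_box bij_betw_def by (metis UNIV_I imageE image_eqI)
  then have "of_real_vec -` box l u = box (to_real l) (to_real u)"
    by (auto simp: mem_box_cart of_real_vec_inner_cbasis to_real_def)
  then have "emeasure (distr lborel borel of_real_vec) (box l u) = emeasure lborel (box (to_real l) (to_real u))"
    using m by (subst emeasure_distr) auto
  also have "\<dots> = (\<Prod>b\<in>Basis. (to_real u - to_real l) \<bullet> b)"
    using lu[OF cbasis_in_Basis] by (intro emeasure_lborel_box) (auto simp: Basis_vec_def inner_axis to_real_def)
  also have "(\<Prod>b\<in>Basis. (to_real u - to_real l) \<bullet> b) = (\<Prod>k\<in>UNIV. (u - l) \<bullet> cbasis k)"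
    by (subst prod.reindex_bij_betw[symmetric, where h = "\<lambda>k. axis k 1" and S = UNIV])
      (auto simp: bij_betw_def inj_on_def Basis_vec_def axis_eq_axis inner_axis to_real_def inner_diff_left)
  also have "\<dots> = (\<Prod>b\<in>Basis. (u - l) \<bullet> b)"
    by (rule prod.reindex_bij_betw[OF bij_betw_cbasis])
  finally show "emeasure (distr lborel borel of_real_vec) (box l u) = (\<Prod>b\<in>Basis. (u - l) \<bullet> b)" .
qed simp

lemma set_integral_of_real_vec:
  fixes f :: "complex ^ 'n \<Rightarrow> real"
  assumes "set_borel_measurable borel S f"
  shows "set_integrable lborel S f \<longleftrightarrow> set_integrable lborel (to_real ` S) (\<lambda>y. f (of_real_vec y))"
    and "set_lebesgue_integral lborel S f = set_lebesgue_integral lborel (to_real ` S) (\<lambda>y. f (of_real_vec y))"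
proof -
  have m: "of_real_vec \<in> measurable lborel borel"
    using borel_measurable_continuous_onI[OF continuous_on_of_real_vec] by simp
  have i: "indicator S (of_real_vec y) = (indicator (to_real ` S) y :: real)" for y
    by (auto simp: indicator_def intro: image_eqI[of y to_real "of_real_vec y"])
  show "set_integrable lborel S f \<longleftrightarrow> set_integrable lborel (to_real ` S) (\<lambda>y. f (of_real_vec y))"
    unfolding set_integrable_def
    by (subst lborel_distr_of_real_vec, subst integrable_distr_eq)
      (use m assms in \<open>auto simp: i set_borel_measurable_def\<close>)
  show "set_lebesgue_integral lborel S f = set_lebesgue_integral lborel (to_real ` S) (\<lambda>y. f (of_real_vec y))"
    unfolding set_lebesgue_integral_def
    by (subst lborel_distr_of_real_vec, subst integral_distr)
      (use m assms in \<open>auto simp: i set_borel_measurable_def\<close>)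
qed

text \<open>Passes between the integral with respect to \<open>lborel\<close> used in the
  definitions and the absolute integrability in which the change of variables theorem is
  phrased.\<close>

lemma set_integrable_lborel_iff:
  fixes f :: "'a::euclidean_space \<Rightarrow> real"
  assumes "set_borel_measurable borel S f"
  shows "set_integrable lborel S f \<and> (LINT x:S|lborel. f x) = b \<longleftrightarrow> f absolutely_integrable_on S \<and> integral S f = b"
proof -
  have "set_integrable lborel S f \<longleftrightarrow> f absolutely_integrable_on S"
    unfolding set_integrable_def
    by (rule integrable_completion[symmetric]) (use assms in \<open>simp add: set_borel_measurable_def\<close>)
  then show ?thesis
    using set_borel_integral_eq_integral(2) by metis
qed

lemma mat_mult_vec: "mat c *v v = c *s (v :: complex ^ 'n)"
  unfolding matrix_vector_mult_def mat_def vec_eq_iff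
  by (simp add: if_distrib[of "\<lambda>x. x * _"] sum.delta cong: if_cong)

lemma matrix_modulus_real_det:
  "matrix_modulus (\<lambda>A :: complex ^ 'n ^ 'n. \<bar>det (matrix (to_real \<circ> (*v) A \<circ> of_real_vec))\<bar>)"
proof
  have lin: "linear (to_real \<circ> (*v) A \<circ> of_real_vec)" for A :: "complex ^ 'n ^ 'n"
  proof -
    have "linear ((*v) A)"
      by (rule linearI) (auto simp: matrix_vector_right_distrib scaleR_eq_vector_scalar_mult matrix_vector_mult_smult)
    then show ?thesis
      by (intro linear_compose linear_to_real linear_of_real_vec)
  qed
  fix A B :: "complex ^ 'n ^ 'n"
  have "to_real \<circ> (*v) (A ** B) \<circ> of_real_vec = (to_real \<circ> (*v) A \<circ> of_real_vec) \<circ> (to_real \<circ> (*v) B \<circ> of_real_vec)"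
    by (auto simp: matrix_vector_mul_assoc)
  then show "\<bar>det (matrix (to_real \<circ> (*v) (A ** B) \<circ> of_real_vec))\<bar>
      = \<bar>det (matrix (to_real \<circ> (*v) A \<circ> of_real_vec))\<bar> * \<bar>det (matrix (to_real \<circ> (*v) B \<circ> of_real_vec))\<bar>"
    by (simp only: matrix_compose[OF lin lin] det_mul abs_mult)
  fix c :: complex
  \<comment> \<open>Polar form: the factor |c| scales 2n real coordinates, and multiplication by the
    unimodular u is an isometry, hence has real determinant of modulus 1. The value 1 at c = 0 keeps
    u unimodular.\<close>
  define u where "u = (if c = 0 then 1 else c / of_real (cmod c))"
  have u: "c = of_real (cmod c) * u" "cmod u = 1"
    by (auto simp: u_def norm_divide)
  have "to_real \<circ> (*v) (mat c :: complex ^ 'n ^ 'n) \<circ> of_real_vec = (\<lambda>y. cmod c *\<^sub>R y) \<circ> (to_real \<circ> (*v) (mat u :: complex ^ 'n ^ 'n) \<circ> of_real_vec)"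
  proof
    fix y :: "real ^ 'n bit0"
    have "c *s of_real_vec y = cmod c *\<^sub>R (u *s of_real_vec y)"
      by (subst u(1)) (simp add: scaleR_eq_vector_scalar_mult)
    then show "(to_real \<circ> (*v) (mat c :: complex ^ 'n ^ 'n) \<circ> of_real_vec) y = ((\<lambda>y. cmod c *\<^sub>R y) \<circ> (to_real \<circ> (*v) (mat u :: complex ^ 'n ^ 'n) \<circ> of_real_vec)) y"
      by (simp add: mat_mult_vec linear_cmul[OF linear_to_real])
  qed
  then have "det (matrix (to_real \<circ> (*v) (mat c :: complex ^ 'n ^ 'n) \<circ> of_real_vec))
     = cmod c ^ (2 * CARD('n)) * det (matrix (to_real \<circ> (*v) (mat u :: complex ^ 'n ^ 'n) \<circ> of_real_vec))"
    by (simp only: matrix_compose[OF lin linear_scaleR] det_mul det_matrix_scaleR card_bit0)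
  moreover have "orthogonal_transformation (to_real \<circ> (*v) (mat u :: complex ^ 'n ^ 'n) \<circ> of_real_vec)"
    unfolding orthogonal_transformation using lin u(2)
    by (auto simp: norm_to_real mat_mult_vec norm_vector_scalar_mult norm_of_real_vec)
  then have "\<bar>det (matrix (to_real \<circ> (*v) (mat u :: complex ^ 'n ^ 'n) \<circ> of_real_vec))\<bar> = 1"
    by simp
  ultimately show "\<bar>det (matrix (to_real \<circ> (*v) (mat c :: complex ^ 'n ^ 'n) \<circ> of_real_vec))\<bar> = cmod c ^ (2 * CARD('n))"
    by (simp add: abs_mult)
qed auto

lemma real_det_eq: "\<bar>det (matrix (to_real \<circ> (*v) A \<circ> of_real_vec))\<bar> = (cmod (det (A :: complex ^ 'n ^ 'n)))\<^sup>2"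
  by (rule matrix_modulus_unique[OF matrix_modulus_real_det matrix_modulus_det])

lemma set_borel_measurable_continuous_open:
  fixes f :: "'a::euclidean_space \<Rightarrow> real"
  assumes "open S" "continuous_on S f"
  shows "set_borel_measurable borel S f"
  unfolding set_borel_measurable_def
  by (rule borel_measurable_continuous_on_indicator) (use assms in auto)

text \<open>The arbitrary value b lets one equivalence carry both integrability and the value of the
  integral, in either direction. The weight is the real Jacobian, by
  \<open>real_det_eq\<close>.\<close>

theorem change_of_variables_holo:
  fixes F :: "complex ^ 'n \<Rightarrow> complex ^ 'n"
  assumes S: "open S" and F: "holo_map_on F S" "inj_on F S" and T: "F ` S = T" "open T"
    and f: "continuous_on T f"
  shows "set_integrable lborel S (\<lambda>z. (cmod (det (jac F z)))\<^sup>2 * f (F z)) \<and>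
      (LINT z:S|lborel. (cmod (det (jac F z)))\<^sup>2 * f (F z)) = b
     \<longleftrightarrow> set_integrable lborel T f \<and> (LINT z:T|lborel. f z) = b"
proof -
  let ?h = "\<lambda>z. (cmod (det (jac F z)))\<^sup>2 * f (F z)"
  have h: "continuous_on S ?h"
    by (intro continuous_intros holo_on_imp_continuous_on[OF holo_on_det_jac[OF F(1) S]]
        continuous_on_compose2[OF f holo_map_on_imp_continuous_on[OF F(1)]]) (use T in auto)
  define G where "G = to_real \<circ> F \<circ> of_real_vec"
  have op: "open (to_real ` U)" if "open U" for U :: "(complex ^ 'n) set"
  proof -
    have "to_real ` U = of_real_vec -` U"
      by (auto simp: image_iff) (metis to_of_real_vec)
    then show ?thesis
      using that by (simp add: open_vimage continuous_on_of_real_vec)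
  qed
  have cf: "continuous_on (to_real ` U) (\<lambda>y. g (of_real_vec y))" if "continuous_on U g" for g :: "complex ^ 'n \<Rightarrow> real" and U
    by (rule continuous_on_compose2[OF that continuous_on_of_real_vec]) auto
  have GT: "G ` (to_real ` S) = to_real ` T"
    using T(1) by (auto simp: G_def image_comp o_def)
  have der: "(G has_derivative (to_real \<circ> (*v) (jac F (of_real_vec y)) \<circ> of_real_vec)) (at y within to_real ` S)"
    if "y \<in> to_real ` S" for y
  proof -
    have lin: "(L has_derivative L) (at x)" if "linear L" for L :: "'x::euclidean_space \<Rightarrow> 'y::euclidean_space" and x
      using that by (simp add: linear_imp_has_derivative)
    have "of_real_vec y \<in> S" using that by auto
    from diff_chain_at[OF diff_chain_at[OF lin[OF linear_of_real_vec] holo_map_on_has_derivative[OF F(1) this]] lin[OF linear_to_real]]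
    show ?thesis
      unfolding G_def by (auto simp: o_assoc intro: has_derivative_at_withinI)
  qed
  have inj: "inj_on G (to_real ` S)"
    using F(2) by (auto simp: inj_on_def G_def) (metis of_to_real_vec)
  have leb: "to_real ` S \<in> sets lebesgue"
    using op[OF S] by (simp add: borel_open sets_completionI_sets)
  have "(\<lambda>y. \<bar>det (matrix (to_real \<circ> (*v) (jac F (of_real_vec y)) \<circ> of_real_vec))\<bar> * f (of_real_vec (G y))) absolutely_integrable_on (to_real ` S) \<and>
      integral (to_real ` S) (\<lambda>y. \<bar>det (matrix (to_real \<circ> (*v) (jac F (of_real_vec y)) \<circ> of_real_vec))\<bar> * f (of_real_vec (G y))) = b
     \<longleftrightarrow> (\<lambda>y. f (of_real_vec y)) absolutely_integrable_on (G ` to_real ` S) \<and> integral (G ` to_real ` S) (\<lambda>y. f (of_real_vec y)) = b"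
    by (rule has_absolute_integral_change_of_variables_scalar[OF leb der inj])
  then have "(\<lambda>y. ?h (of_real_vec y)) absolutely_integrable_on (to_real ` S) \<and>
      integral (to_real ` S) (\<lambda>y. ?h (of_real_vec y)) = b
     \<longleftrightarrow> (\<lambda>y. f (of_real_vec y)) absolutely_integrable_on (to_real ` T) \<and> integral (to_real ` T) (\<lambda>y. f (of_real_vec y)) = b"
    unfolding real_det_eq GT by (simp add: G_def)
  then show ?thesis
    unfolding set_integral_of_real_vec[OF set_borel_measurable_continuous_open[OF S h]]
      set_integral_of_real_vec[OF set_borel_measurable_continuous_open[OF T(2) f]]
      set_integrable_lborel_iff[OF set_borel_measurable_continuous_open[OF op[OF S] cf[OF h]]]
      set_integrable_lborel_iff[OF set_borel_measurable_continuous_open[OF op[OF T(2)] cf[OF f]]] .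
qed

subsection \<open>Circle averages\<close>

abbreviation circ :: "real \<Rightarrow> complex" where
  "circ t \<equiv> cis (2 * pi * t)"

text \<open>The maximum modulus principle is applied to the product of the rotates of \<open>g\<close> by the
  \<open>N\<close>-th roots of unity, followed by the inequality of the means. Zeros of \<open>g\<close> do not matter.\<close>

lemma power_sub_mean_value_discrete:
  assumes g: "g holomorphic_on U" "open U" "cball 0 1 \<subseteq> U" and N: "N > 0" and p: "p > (0::real)"
  shows "\<exists>s\<in>{0..1}. real N * cmod (g 0) powr p \<le> (\<Sum>j<N. cmod (g (circ (s + real j / real N))) powr p)"
proof -
  define G where "G l = (\<Prod>j<N. g (circ (real j / real N) * l))" for l
  have cont: "continuous_on (cball 0 1) G"
    unfolding G_def
    by (intro continuous_on_prod continuous_on_compose2[OF holomorphic_on_imp_continuous_on[OF g(1)]] continuous_intros)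
      (use g(3) in \<open>auto simp: norm_mult\<close>)
  have "(\<lambda>l. cis a * l) ` ball 0 1 \<subseteq> U" for a
    using g(3) by (auto simp: norm_mult)
  then have hol: "G holomorphic_on ball 0 1"
    unfolding G_def
    by (intro holomorphic_on_prod holomorphic_on_compose_gen[OF _ g(1), unfolded o_def] holomorphic_intros)
  have "continuous_on (sphere 0 1) (\<lambda>l. cmod (G l))"
    by (intro continuous_intros continuous_on_subset[OF cont]) auto
  then obtain l where l: "l \<in> sphere 0 1" "\<And>y. y \<in> sphere 0 1 \<Longrightarrow> cmod (G y) \<le> cmod (G l)"
    using continuous_attains_sup[of "sphere 0 (1::real) :: complex set" "\<lambda>l. cmod (G l)"] by auto
  have "cmod (G 0) \<le> cmod (G l)"
    by (rule maximum_modulus_frontier[of G "cball 0 1"]) (use cont hol l in auto)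
  then have le: "cmod (g 0) ^ N \<le> (\<Prod>j<N. cmod (g (circ (real j / real N) * l)))"
    by (simp add: G_def norm_power flip: prod_norm)
  obtain \<theta> where \<theta>: "0 \<le> \<theta>" "\<theta> < 2 * pi" "l = cis \<theta>"
    using l(1) complex_norm_eq_1_exp[of l] Arg2pi[of l] by (auto simp: cis_conv_exp complex_norm_eq_1_exp_eq)
  define s where "s = \<theta> / (2 * pi)"
  have s: "s \<in> {0..1}" "l = circ s"
    using \<theta> by (auto simp: s_def field_simps)
  have "cmod (g 0) powr p = (cmod (g 0) ^ N) powr (p / real N)"
    using N by (cases "g 0 = 0") (simp_all add: powr_powr flip: powr_realpow)
  also have "\<dots> \<le> (\<Prod>j<N. cmod (g (circ (real j / real N) * l))) powr (p / real N)"
    using p by (intro powr_mono2 le) auto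
  also have "\<dots> = (\<Prod>j<N. cmod (g (circ (real j / real N) * l)) powr p) powr (1 / real N)"
    by (simp add: powr_powr flip: prod_powr_distrib)
  also have "\<dots> \<le> (\<Sum>j<N. cmod (g (circ (real j / real N) * l)) powr p / real N)"
    using arith_geom_mean[of "{..<N}" "\<lambda>j. cmod (g (circ (real j / real N) * l)) powr p"] N by (simp add: lessThan_empty_iff)
  finally have "real N * cmod (g 0) powr p \<le> (\<Sum>j<N. cmod (g (circ (real j / real N) * l)) powr p)"
    using N by (simp add: field_simps flip: sum_divide_distrib)
  moreover have "circ (real j / real N) * l = circ (s + real j / real N)" for j
    unfolding s(2) by (simp add: cis_mult algebra_simps)
  ultimately show ?thesis using s(1) by auto
qed

text \<open>On each cell the value at the left endpoint exceeds the other values by at most e, so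
  the Riemann sum overshoots the integral by at most e.\<close>

lemma sum_le_integral_of_oscillation:
  fixes u :: "real \<Rightarrow> real"
  assumes u: "continuous_on {s..s+1} u" and N: "N > 0"
    and osc: "\<And>x y. x \<in> {s..s+1} \<Longrightarrow> y \<in> {s..s+1} \<Longrightarrow> \<bar>x - y\<bar> \<le> 1 / real N \<Longrightarrow> u x \<le> u y + e"
  shows "(\<Sum>j<N. u (s + real j / real N)) / N \<le> integral {s..s+1} u + e"
proof -
  have int: "u integrable_on {a..b}" if "{a..b} \<subseteq> {s..s+1}" for a b
    using that by (intro integrable_continuous_real continuous_on_subset[OF u])
  have "(\<Sum>j<n. u (s + real j / real N)) / N \<le> integral {s..s + real n / real N} u + real n / real N * e" if "n \<le> N" for n
    using that
  proof (induction n)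
    case (Suc n)
    let ?a = "s + real n / real N" and ?b = "s + real (Suc n) / real N"
    have ab: "s \<le> ?a" "?a \<le> ?b" "?b \<le> s + 1" "?b - ?a = 1 / real N"
      using Suc.prems N by (auto simp: field_simps)
    have "(u ?a - e) * (1 / real N) = integral {?a..?b} (\<lambda>_. u ?a - e)"
      using ab by simp
    also have "\<dots> \<le> integral {?a..?b} u"
    proof (rule integral_le)
      fix x assume "x \<in> {?a..?b}"
      then show "u ?a - e \<le> u x"
        using osc[of ?a x] ab by auto
    qed (use ab int in auto)
    also have "\<dots> = integral {s..?b} u - integral {s..?a} u"
      using Henstock_Kurzweil_Integration.integral_combine[of s ?a ?b u] ab int[of s ?b] by auto
    finally show ?case
      using Suc by (simp add: add_divide_distrib algebra_simps)
  qed simp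
  from this[of N] show ?thesis using N by simp
qed

text \<open>The discrete mean value inequality starts at an uncontrolled point s of the circle;
  periodicity removes it.\<close>

lemma integral_period:
  fixes u :: "real \<Rightarrow> real"
  assumes s: "s \<in> {0..1}" and u: "continuous_on {0..2} u" and per: "\<And>t. u (t + 1) = u t"
  shows "integral {s..s+1} u = integral {0..1} u"
proof -
  have int: "u integrable_on {a..b}" if "{a..b} \<subseteq> {0..2}" for a b
    using that by (intro integrable_continuous_real continuous_on_subset[OF u])
  have "integral {0..s} u = integral {1..s+1} u"
    using integral_shift_Icc_real[of 0 s u 1] per by (simp add: o_def add.commute)
  moreover have "integral {s..1} u + integral {1..s+1} u = integral {s..s+1} u"
    using s by (intro Henstock_Kurzweil_Integration.integral_combine int) auto
  moreover have "integral {0..s} u + integral {s..1} u = integral {0..1} u"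
    using s by (intro Henstock_Kurzweil_Integration.integral_combine int) auto
  ultimately show ?thesis by simp
qed

text \<open>Limit of the discrete inequality as the number of roots of unity grows. The starting
  point s varies with N, so the Riemann sums must be controlled uniformly in s; uniform continuity
  on two periods gives this.\<close>

lemma power_sub_mean_value:
  assumes g: "g holomorphic_on U" "open U" "cball 0 1 \<subseteq> U" and p: "p > (0::real)"
  shows "cmod (g 0) powr p \<le> integral {0..1} (\<lambda>t. cmod (g (circ t)) powr p)"
proof (rule field_le_epsilon)
  fix e :: real assume e: "e > 0"
  define u where "u = (\<lambda>t. cmod (g (circ t)) powr p)"
  have u: "continuous_on S u" for S
    unfolding u_def
    by (intro continuous_on_powr' continuous_intros continuous_on_compose2[OF holomorphic_on_imp_continuous_on[OF g(1)]])
      (use g(3) p in auto)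
  have per: "u (t + 1) = u t" for t
    by (simp add: u_def distrib_left cis_mult[symmetric])
  have "uniformly_continuous_on {0..2} u"
    by (intro compact_uniformly_continuous u) simp
  then obtain d where d: "d > 0" "\<And>x y. x \<in> {0..2} \<Longrightarrow> y \<in> {0..2} \<Longrightarrow> dist y x < d \<Longrightarrow> dist (u y) (u x) < e"
    unfolding uniformly_continuous_on_def using e by metis
  obtain n where "1 / real (Suc n) < d"
    using d(1) by (rule nat_approx_posE)
  define N where "N = Suc n"
  have N: "N > 0" "1 / real N < d"
    using \<open>1 / real (Suc n) < d\<close> by (simp_all add: N_def)
  from power_sub_mean_value_discrete[OF g N(1) p]
  obtain s where s: "s \<in> {0..1}" "real N * cmod (g 0) powr p \<le> (\<Sum>j<N. u (s + real j / real N))"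
    by (auto simp: u_def)
  have "cmod (g 0) powr p \<le> (\<Sum>j<N. u (s + real j / real N)) / N"
    using s(2) N by (simp add: field_simps)
  also have "\<dots> \<le> integral {s..s+1} u + e"
  proof (rule sum_le_integral_of_oscillation[OF u N(1)])
    fix x y assume "x \<in> {s..s+1}" "y \<in> {s..s+1}" "\<bar>x - y\<bar> \<le> 1 / real N"
    then show "u x \<le> u y + e"
      using d(2)[of y x] N(2) s(1) by (auto simp: dist_real_def)
  qed
  also have "integral {s..s+1} u = integral {0..1} u"
    by (rule integral_period[OF s(1) u per])
  finally show "cmod (g 0) powr p \<le> integral {0..1} (\<lambda>t. cmod (g (circ t)) powr p) + e"
    by (simp add: u_def)
qed

section \<open>Rotation invariance on circular domains\<close>

lemma complete_circularD: "complete_circular \<Omega> \<Longrightarrow> z \<in> \<Omega> \<Longrightarrow> cmod t \<le> 1 \<Longrightarrow> t *s z \<in> \<Omega>"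
  by (simp add: complete_circular_def)

lemma complete_circular_rotate_iff:
  assumes "complete_circular \<Omega>" "cmod c = 1"
  shows "c *s z \<in> \<Omega> \<longleftrightarrow> z \<in> \<Omega>"
proof
  assume "c *s z \<in> \<Omega>"
  then have "inverse c *s (c *s z) \<in> \<Omega>"
    by (rule complete_circularD[OF assms(1)]) (simp add: norm_inverse assms)
  moreover have "c \<noteq> 0" using assms by auto
  ultimately show "z \<in> \<Omega>" by simp
qed (use assms in \<open>auto intro: complete_circularD\<close>)

lemma holo_map_on_smult: "holo_map_on (\<lambda>z. c *s z) \<Omega>"
  by (auto simp: holo_map_on_def intro!: holo_on_mult holo_on_const holo_on_component)

lemma jac_smult: "jac (\<lambda>z. c *s z) z = (mat c :: complex ^ 'n ^ 'n)"
  by (rule jac_unique[OF holo_map_on_smult[of _ UNIV]])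
    (auto simp: mat_mult_vec[abs_def] intro!: bounded_linear_imp_has_derivative bounded_linear_vector_scalar_mult_right)

lemma set_integral_rotate:
  fixes \<Omega> :: "(complex ^ 'n) set"
  assumes "open \<Omega>" "complete_circular \<Omega>" "cmod c = 1" "continuous_on \<Omega> f"
  shows "set_integrable lborel \<Omega> (\<lambda>z. f (c *s z)) \<longleftrightarrow> set_integrable lborel \<Omega> (f :: _ \<Rightarrow> real)"
    and "(LINT z:\<Omega>|lborel. f (c *s z)) = (LINT z:\<Omega>|lborel. f z)"
proof -
  have c: "c \<noteq> 0" using assms by auto
  have "(\<lambda>z. c *s z) ` \<Omega> = \<Omega>"
  proof
    show "\<Omega> \<subseteq> (\<lambda>z. c *s z) ` \<Omega>"
    proof
      fix z assume "z \<in> \<Omega>"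
      then have "inverse c *s z \<in> \<Omega>"
          by (intro complete_circularD[OF assms(2)]) (auto simp: norm_inverse assms)
      moreover have "z = c *s (inverse c *s z)" using c by simp
      ultimately show "z \<in> (\<lambda>z. c *s z) ` \<Omega>" by blast
    qed
  qed (use assms complete_circular_rotate_iff in auto)
  moreover have "inj_on (\<lambda>z :: complex ^ 'n. c *s z) \<Omega>"
    using c by (auto simp: inj_on_def vec_eq_iff)
  moreover have "cmod (det (mat c :: complex ^ 'n ^ 'n)) = 1"
    by (subst det_diagonal) (auto simp: mat_def norm_power assms)
  ultimately have *: "set_integrable lborel \<Omega> (\<lambda>z. f (c *s z)) \<and> (LINT z:\<Omega>|lborel. f (c *s z)) = b
     \<longleftrightarrow> set_integrable lborel \<Omega> f \<and> (LINT z:\<Omega>|lborel. f z) = b" for b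
    using change_of_variables_holo[OF assms(1) holo_map_on_smult, of c \<Omega> f b] assms by (simp add: jac_smult)
  show 1: "set_integrable lborel \<Omega> (\<lambda>z. f (c *s z)) \<longleftrightarrow> set_integrable lborel \<Omega> f"
    using * by blast
  show "(LINT z:\<Omega>|lborel. f (c *s z)) = (LINT z:\<Omega>|lborel. f z)"
  proof (cases "set_integrable lborel \<Omega> f")
    case True then show ?thesis using * by blast
  next
    \<comment> \<open>If f is not integrable, neither is its rotate, and both integrals take the
      default value 0.\<close>
    case False
    with 1 show ?thesis
      by (simp add: set_integrable_def set_lebesgue_integral_def not_integrable_integral_eq)
  qed
qed

text \<open>By Fubini and rotation invariance the circle averages of u have the same integral over
  \<Omega> as u, so mean value inequalities on complex lines become inequalities of integrals. The
  sign of u is left free: in \<open>A2_remainder\<close> it is a difference of squares.\<close>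

lemma circular_integral_mono:
  fixes \<Omega> :: "(complex ^ 'n) set"
  assumes \<Omega>: "open \<Omega>" "complete_circular \<Omega>"
    and u: "continuous_on \<Omega> u" "set_integrable lborel \<Omega> u"
    and w: "set_integrable lborel \<Omega> w"
    and le: "\<And>z. z \<in> \<Omega> \<Longrightarrow> w z \<le> integral {0..1} (\<lambda>t. u (circ t *s z))"
  shows "(LINT z:\<Omega>|lborel. w z) \<le> (LINT z:\<Omega>|lborel. u z :: real)"
proof -
  \<comment> \<open>Both ranges of integration become indicators, so that Fubini's theorem applies
    on the full product.\<close>
  define H where "H = (\<lambda>t z. indicator {0..1::real} t * (indicator \<Omega> z * u (circ t *s z)))"
  have rot: "circ t *s z \<in> \<Omega>" if "z \<in> \<Omega>" for t z
    using that by (intro complete_circularD[OF \<Omega>(2)]) auto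
  have abs_u: "continuous_on \<Omega> (\<lambda>z. \<bar>u z\<bar>)" "set_integrable lborel \<Omega> (\<lambda>z. \<bar>u z\<bar>)"
    using u by (auto intro!: continuous_intros set_integrable_abs)
  have "continuous_on (UNIV \<times> \<Omega>) (\<lambda>x. u (circ (fst x) *s snd x))"
    by (intro continuous_on_compose2[OF u(1)] continuous_intros) (auto simp: rot)
  then have "(\<lambda>x. indicator (UNIV \<times> \<Omega>) x *\<^sub>R u (circ (fst x) *s snd x)) \<in> borel_measurable borel"
    using \<Omega>(1) by (intro borel_measurable_continuous_on_indicator borel_open open_Times) auto
  moreover have "(indicator ({0..1} \<times> UNIV) :: real \<times> (complex ^ 'n) \<Rightarrow> real) \<in> borel_measurable borel"
    by (intro borel_measurable_indicator borel_closed closed_Times) auto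
  ultimately have "(\<lambda>x. indicator ({0..1} \<times> UNIV) x * (indicator (UNIV \<times> \<Omega>) x *\<^sub>R u (circ (fst x) *s snd x))) \<in> borel_measurable borel"
    by (rule borel_measurable_times[rotated])
  also have "(\<lambda>x. indicator ({0..1} \<times> UNIV) x * (indicator (UNIV \<times> \<Omega>) x *\<^sub>R u (circ (fst x) *s snd x))) = case_prod H"
    by (auto simp: H_def indicator_def)
  finally have meas: "case_prod H \<in> borel_measurable (lborel \<Otimes>\<^sub>M lborel)"
    by (simp add: lborel_prod)
  have inner_int: "integrable lborel (\<lambda>z. H t z)" for t
  proof -
    have "set_integrable lborel \<Omega> (\<lambda>z. u (circ t *s z))"
      using set_integral_rotate(1)[OF \<Omega> _ u(1), of "circ t"] u(2) by simp
    then show ?thesis by (simp add: H_def set_integrable_def)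
  qed
  have norm_inner: "(\<integral>z. norm (H t z) \<partial>lborel) = indicator {0..1} t * (LINT z:\<Omega>|lborel. \<bar>u z\<bar>)" for t
    using set_integral_rotate(2)[OF \<Omega> _ abs_u(1), of "circ t"]
    by (simp add: H_def set_lebesgue_integral_def abs_mult)
  have inner: "(\<integral>z. H t z \<partial>lborel) = indicator {0..1} t * (LINT z:\<Omega>|lborel. u z)" for t
    using set_integral_rotate(2)[OF \<Omega> _ u(1), of "circ t"]
    by (simp add: H_def set_lebesgue_integral_def)
  have one: "integrable lborel (\<lambda>t. indicator {0..1::real} t * c :: real)" for c
    by (intro integrable_mult_left integrable_real_indicator) auto
  have int: "integrable (lborel \<Otimes>\<^sub>M lborel) (case_prod H)"
  proof (rule lborel_pair.Fubini_integrable[OF meas])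
    show "integrable lborel (\<lambda>t. \<integral>z. norm (case (t, z) of (t, z) \<Rightarrow> H t z) \<partial>lborel)"
      by (simp only: case_prod_conv norm_inner one)
    show "AE t in lborel. integrable lborel (\<lambda>z. case (t, z) of (t, z) \<Rightarrow> H t z)"
      by (simp add: inner_int)
  qed
  have "(LINT z:\<Omega>|lborel. w z) \<le> (\<integral>z. (\<integral>t. H t z \<partial>lborel) \<partial>lborel)"
    unfolding set_lebesgue_integral_def
  proof (rule integral_mono)
    fix z
    show "indicator \<Omega> z *\<^sub>R w z \<le> (\<integral>t. H t z \<partial>lborel)"
    proof (cases "z \<in> \<Omega>")
      case True
      have "continuous_on {0..1} (\<lambda>t. u (circ t *s z))"
        by (intro continuous_on_compose2[OF u(1)] continuous_intros) (auto simp: rot True)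
      then have "set_integrable lborel {0..1} (\<lambda>t. u (circ t *s z))"
        unfolding set_integrable_def by (intro borel_integrable_compact) auto
      then have "integral {0..1} (\<lambda>t. u (circ t *s z)) = (\<integral>t. H t z \<partial>lborel)"
        using True by (simp add: set_borel_integral_eq_integral(2)[symmetric] H_def set_lebesgue_integral_def)
      with le[OF True] True show ?thesis by simp
    qed (simp add: H_def)
  qed (use w lborel_pair.integrable_snd[OF int] in \<open>simp_all add: set_integrable_def\<close>)
  also have "\<dots> = (\<integral>t. (\<integral>z. H t z \<partial>lborel) \<partial>lborel)"
    by (rule lborel_pair.Fubini_integral[OF int])
  also have "\<dots> = (LINT z:\<Omega>|lborel. u z)"
    by (simp add: inner)
  finally show ?thesis .
qed

subsection \<open>Integral estimates on circular domains\<close>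

lemma circle_mean_value:
  assumes k: "k holomorphic_on U" "open U" "cball 0 1 \<subseteq> U"
  shows "((\<lambda>t. k (circ t)) has_integral k 0) {0..1}"
proof -
  have "((\<lambda>u. k u / (u - 0)) has_contour_integral 2 * of_real pi * \<i> * k 0) (circlepath 0 1)"
    using k by (intro Cauchy_integral_circlepath_simple holomorphic_on_subset[OF k(1)]) auto
  then have "((\<lambda>t. (1 / (2 * of_real pi * \<i>)) * (k (circlepath 0 1 t) / circlepath 0 1 t * vector_derivative (circlepath 0 1) (at t)))
     has_integral (1 / (2 * of_real pi * \<i>)) * (2 * of_real pi * \<i> * k 0)) {0..1}"
    unfolding has_contour_integral by (intro has_integral_mult_right) simp
  moreover have "(1 / (2 * of_real pi * \<i>)) * (k (circlepath 0 1 t) / circlepath 0 1 t * vector_derivative (circlepath 0 1) (at t))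
      = k (circ t)" for t
    unfolding vector_derivative_circlepath
    by (simp add: circlepath cis_conv_exp field_simps)
  ultimately show ?thesis
    by simp
qed

text \<open>Parseval's identity for the first two Taylor coefficients, with the remainder in place
  of the rest of the series. On the unit circle the conjugate of l is 1 / l, so the cross terms are
  real parts of holomorphic functions vanishing at 0 and have mean 0.\<close>

lemma circle_orthogonality:
  assumes g: "g holomorphic_on U" "open U" "cball 0 1 \<subseteq> U"
  shows "((\<lambda>t. (cmod (g (circ t)))\<^sup>2 - (cmod (g (circ t) - g 0 - deriv g 0 * circ t))\<^sup>2) has_integral
     (cmod (g 0))\<^sup>2 + (cmod (deriv g 0))\<^sup>2) {0..1}"
proof -
  let ?a = "g 0" and ?b = "deriv g 0"
  have 0: "0 \<in> U" using g(3) by auto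
  define R where "R l = g l - ?a - ?b * l" for l
  have R: "R holomorphic_on U"
    unfolding R_def by (intro holomorphic_intros g)
  have "(g has_field_derivative ?b) (at 0)"
    using g(1,2) 0 by (rule holomorphic_derivI)
  then have "(R has_field_derivative ?b - 0 - ?b * 1) (at 0)"
    unfolding R_def by (auto intro!: derivative_eq_intros)
  then have dR: "deriv R 0 = 0"
    by (intro DERIV_imp_deriv) simp
  \<comment> \<open>The quotient R(l) / l, continued holomorphically across 0 with value R'(0) = 0;
    on the circle it is the conjugate of l times R(l).\<close>
  define R1 where "R1 l = (if l = 0 then deriv R 0 else (R l - R 0) / (l - 0))" for l
  have "R1 holomorphic_on U"
    unfolding R1_def by (rule pole_lemma_open[OF R g(2)])
  then have "(\<lambda>l. 2 * cnj ?a * ?b * l + 2 * (cnj ?a * R l + cnj ?b * R1 l)) holomorphic_on U"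
    by (intro holomorphic_intros R)
  from circle_mean_value[OF this g(2,3)]
  have "((\<lambda>t. 2 * cnj ?a * ?b * circ t + 2 * (cnj ?a * R (circ t) + cnj ?b * R1 (circ t))) has_integral 0) {0..1}"
    by (simp add: R1_def dR) (simp add: R_def)
  note Re = has_integral_Re[OF this]
  have "((\<lambda>t::real. (cmod ?a)\<^sup>2 + (cmod ?b)\<^sup>2) has_integral (cmod ?a)\<^sup>2 + (cmod ?b)\<^sup>2) {0..1}"
    using has_integral_const_real[of "(cmod ?a)\<^sup>2 + (cmod ?b)\<^sup>2" 0 1] by simp
  from has_integral_add[OF this Re]
  have "((\<lambda>t. ((cmod ?a)\<^sup>2 + (cmod ?b)\<^sup>2) + Re (2 * cnj ?a * ?b * circ t + 2 * (cnj ?a * R (circ t) + cnj ?b * R1 (circ t))))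
     has_integral ((cmod ?a)\<^sup>2 + (cmod ?b)\<^sup>2) + 0) {0..1}"
    by simp
  moreover have "((cmod ?a)\<^sup>2 + (cmod ?b)\<^sup>2) + Re (2 * cnj ?a * ?b * circ t + 2 * (cnj ?a * R (circ t) + cnj ?b * R1 (circ t)))
     = (cmod (g (circ t)))\<^sup>2 - (cmod (g (circ t) - g 0 - deriv g 0 * circ t))\<^sup>2" for t
  proof -
    let ?l = "circ t"
    have l: "cnj ?l * ?l = 1"
      by (simp add: complex_norm_square[symmetric] mult.commute)
    have R1: "R1 ?l = cnj ?l * R ?l"
    proof -
      have "?l \<noteq> 0" by simp
      then have "R1 ?l = R ?l / ?l"
        unfolding R1_def by (simp add: R_def)
      also have "\<dots> = cnj ?l * R ?l"
        using \<open>?l \<noteq> 0\<close> l by (simp add: field_simps)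
      finally show ?thesis .
    qed
    have "g ?l = ?a + ?b * ?l + R ?l" by (simp add: R_def)
    then have "complex_of_real ((cmod (g ?l))\<^sup>2) = (?a + ?b * ?l + R ?l) * cnj (?a + ?b * ?l + R ?l)"
      by (simp only: complex_norm_square)
    moreover have "complex_of_real ((cmod (R ?l))\<^sup>2) = R ?l * cnj (R ?l)"
      by (simp only: complex_norm_square)
    ultimately have "complex_of_real ((cmod (g ?l))\<^sup>2 - (cmod (R ?l))\<^sup>2)
      = ?a * cnj ?a + ?b * cnj ?b * (cnj ?l * ?l) + (cnj ?a * ?b * ?l + cnj (cnj ?a * ?b * ?l))
        + (cnj (?a + ?b * ?l) * R ?l + cnj (cnj (?a + ?b * ?l) * R ?l))"
      by (simp add: algebra_simps)
    also have "\<dots> = of_real ((cmod ?a)\<^sup>2) + of_real ((cmod ?b)\<^sup>2) + of_real (2 * Re (cnj ?a * ?b * ?l)) + of_real (2 * Re (cnj (?a + ?b * ?l) * R ?l))"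
      by (simp only: complex_norm_square complex_add_cnj l) simp
    finally have "(cmod (g ?l))\<^sup>2 - (cmod (R ?l))\<^sup>2 = (cmod ?a)\<^sup>2 + (cmod ?b)\<^sup>2 + (2 * Re (cnj ?a * ?b * ?l) + 2 * Re (cnj (?a + ?b * ?l) * R ?l))"
      by (simp only: of_real_add[symmetric] of_real_eq_iff add.assoc)
    moreover have "cnj ?a * R ?l + cnj ?b * R1 ?l = cnj (?a + ?b * ?l) * R ?l"
      unfolding R1 by (simp add: algebra_simps)
    moreover have "Re (2 * x * y * v + 2 * w) = 2 * Re (x * y * v) + 2 * Re w" for x y v w
      by (simp add: algebra_simps)
    ultimately show ?thesis
      unfolding R_def[of ?l, symmetric] by (simp only:)
  qed
  ultimately show ?thesis by simp
qed

text \<open>Schwarz's lemma for a zero of order two: divide by l twice and apply the maximum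
  principle to the quotient.\<close>

lemma quadratic_bound_of_double_zero:
  assumes k: "k holomorphic_on U" "open U" "cball 0 d \<subseteq> U" and d: "d > 0"
    and z: "k 0 = 0" "deriv k 0 = 0" and M: "\<And>l. cmod l = d \<Longrightarrow> cmod (k l) \<le> M" and l: "cmod l \<le> d"
  shows "cmod (k l) \<le> (cmod l)\<^sup>2 / d\<^sup>2 * M"
proof -
  define k1 where "k1 l = (if l = 0 then deriv k 0 else (k l - k 0) / (l - 0))" for l
  have k1: "k1 holomorphic_on U"
    unfolding k1_def by (rule pole_lemma_open[OF k(1,2)])
  define k2 where "k2 l = (if l = 0 then deriv k1 0 else (k1 l - k1 0) / (l - 0))" for l
  have k2: "k2 holomorphic_on U"
    unfolding k2_def by (rule pole_lemma_open[OF k1 k(2)])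
  have eq: "k l = l\<^sup>2 * k2 l" for l
    by (auto simp: k2_def k1_def z power2_eq_square)
  have "cmod (k2 l) \<le> M / d\<^sup>2"
  proof (rule maximum_modulus_frontier[of k2 "cball 0 d"])
    show "k2 holomorphic_on interior (cball 0 d)"
      using k(3) by (intro holomorphic_on_subset[OF k2]) auto
    show "continuous_on (closure (cball 0 d)) k2"
      using k(3) by (intro continuous_on_subset[OF holomorphic_on_imp_continuous_on[OF k2]]) auto
    fix x :: complex assume "x \<in> frontier (cball 0 d)"
    then have x: "cmod x = d" using d by (auto simp: dist_norm)
    show "cmod (k2 x) \<le> M / d\<^sup>2"
      using M[OF x] d x eq[of x] by (simp add: norm_mult norm_power field_simps)
  qed (use l in auto)
  then have "(cmod l)\<^sup>2 * cmod (k2 l) \<le> (cmod l)\<^sup>2 * (M / d\<^sup>2)"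
    by (intro mult_left_mono) auto
  then show ?thesis
    by (simp add: eq[of l] norm_mult norm_power)
qed

section \<open>Integrals over open sets\<close>

abbreviation p_integral :: "real \<Rightarrow> (complex ^ 'n) set \<Rightarrow> (complex ^ 'n \<Rightarrow> complex) \<Rightarrow> real" where
  "p_integral p \<Omega> f \<equiv> (LINT z:\<Omega>|lborel. cmod (f z) powr p)"

lemma p_integral_nonneg: "p_integral p \<Omega> f \<ge> 0"
  unfolding set_lebesgue_integral_def by (intro integral_nonneg_AE) auto

lemma p_norm_powr: "p \<noteq> 0 \<Longrightarrow> p_norm p \<Omega> f powr p = p_integral p \<Omega> f"
  by (simp add: p_norm_def powr_powr p_integral_nonneg)

lemma powr_continuous_on:
  assumes "continuous_on \<Omega> f" "p > (0::real)"
  shows "continuous_on \<Omega> (\<lambda>z. cmod (f z) powr p)"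
  using assms by (intro continuous_on_powr' continuous_intros) auto

lemma holo_on_translate:
  assumes "holo_on f \<Omega>"
  shows "holo_on (\<lambda>w. f (z + w)) ((\<lambda>w. z + w) -` \<Omega>)"
proof -
  have "holo_map_on (\<lambda>w. z + w) ((\<lambda>w. z + w) -` \<Omega>)"
    by (auto simp: holo_map_on_def intro!: holo_on_add holo_on_const holo_on_component)
  then show ?thesis
    by (rule holo_on_compose_map[OF _ assms]) auto
qed

lemma set_integral_translate:
  fixes f :: "complex ^ 'n \<Rightarrow> real"
  assumes "open S" "open T" "(\<lambda>w. z + w) ` S = T" "continuous_on T f"
  shows "set_integrable lborel S (\<lambda>w. f (z + w)) \<and> (LINT w:S|lborel. f (z + w)) = b
     \<longleftrightarrow> set_integrable lborel T f \<and> (LINT w:T|lborel. f w) = b"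
proof -
  have h: "holo_map_on (\<lambda>w. z + w) S" for S
    by (auto simp: holo_map_on_def intro!: holo_on_add holo_on_const holo_on_component)
  have "jac (\<lambda>w. z + w) w = mat 1" for w
    by (rule jac_unique[OF h[of UNIV]]) (auto intro!: derivative_eq_intros)
  then show ?thesis
    using change_of_variables_holo[OF assms(1) h _ assms(3,2,4), of b] by simp
qed

lemma small_multiple:
  assumes "e > 0" "x \<ge> (0::real)"
  shows "\<exists>r>0. r * x < e"
proof (intro exI conjI)
  show "e / (x + 1) > 0" using assms by simp
  show "e / (x + 1) * x < e" using assms by (simp add: pos_divide_less_eq distrib_left)
qed

lemma measure_open_pos:
  fixes S :: "'a::euclidean_space set"
  assumes "open S" "bounded S" "S \<noteq> {}"
  shows "measure lborel S > 0"
proof -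
  have fin: "S \<in> fmeasurable lborel"
    using assms by (intro fmeasurableI emeasure_bounded_finite) auto
  have "\<not> negligible S"
    using assms open_not_negligible by blast
  then have "measure lebesgue S \<noteq> 0"
    using fin by (subst measure_completion[symmetric]) (auto simp: negligible_iff_measure0 fmeasurable_def)
  then show ?thesis
    using assms by (simp add: zero_less_measure_iff measure_completion)
qed

lemma set_integral_pos:
  fixes g :: "'a::euclidean_space \<Rightarrow> real"
  assumes S: "open S" and g: "continuous_on S g" "set_integrable lborel S g" "\<And>z. z \<in> S \<Longrightarrow> g z \<ge> 0"
    and z0: "z0 \<in> S" "g z0 > 0"
  shows "(LINT z:S|lborel. g z) > 0"
proof -
  define U where "U = (S \<inter> g -` {g z0 / 2<..}) \<inter> ball z0 1"
  have "open (S \<inter> g -` {g z0 / 2<..})"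
    by (rule continuous_open_preimage[OF g(1) S]) simp
  then have U: "open U" "bounded U" "U \<noteq> {}" "U \<subseteq> S"
    using z0 by (auto simp: U_def)
  have fin: "emeasure lborel U < \<infinity>"
    using U(2) by (rule emeasure_bounded_finite)
  have "0 < g z0 / 2 * measure lborel U"
    using z0 measure_open_pos[OF U(1-3)] by simp
  also have "\<dots> = (LINT z|lborel. indicator U z *\<^sub>R (g z0 / 2))"
    using U(1) fin by simp
  also have "\<dots> \<le> (LINT z:S|lborel. g z)"
    unfolding set_lebesgue_integral_def
  proof (rule integral_mono)
    show "integrable lborel (\<lambda>z. indicator U z *\<^sub>R (g z0 / 2))"
      using U(1) fin by auto
    show "integrable lborel (\<lambda>z. indicator S z *\<^sub>R g z)"
      using g(2) by (simp add: set_integrable_def)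
    show "indicator U z *\<^sub>R (g z0 / 2) \<le> indicator S z *\<^sub>R g z" for z
      using g(3)[of z] U(4) by (auto simp: indicator_def U_def)
  qed
  finally show ?thesis .
qed

text \<open>Interpreted for the domain of the theorem and, in \<open>local_bound\<close>, for a
  small ball, where \<open>p_integral_ge_center\<close> becomes a mean value inequality over
  balls.\<close>

locale circular_domain =
  fixes \<Omega> :: "(complex ^ 'n) set"
  assumes open_\<Omega>: "open \<Omega>" and bounded_\<Omega>: "bounded \<Omega>" and nonempty: "\<Omega> \<noteq> {}"
    and circular: "complete_circular \<Omega>"
begin

lemma zero_in: "0 \<in> \<Omega>"
  using nonempty complete_circularD[OF circular, of _ 0] by auto

abbreviation vol :: real where "vol \<equiv> measure lborel \<Omega>"

lemma vol_pos: "vol > 0"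
  using measure_open_pos[OF open_\<Omega> bounded_\<Omega> nonempty] .

lemma set_integral_const: "set_integrable lborel \<Omega> (\<lambda>z. c :: real)" "(LINT z:\<Omega>|lborel. c :: real) = vol * c"
proof -
  have "emeasure lborel \<Omega> < \<infinity>"
    using bounded_\<Omega> by (rule emeasure_bounded_finite)
  then show "set_integrable lborel \<Omega> (\<lambda>z. c :: real)" "(LINT z:\<Omega>|lborel. c :: real) = vol * c"
    using open_\<Omega> unfolding set_integrable_def set_lebesgue_integral_def by (auto simp: mult.commute)
qed

lemma set_integrable_bounded:
  fixes g :: "complex ^ 'n \<Rightarrow> real"
  assumes "continuous_on \<Omega> g" "\<And>z. z \<in> \<Omega> \<Longrightarrow> \<bar>g z\<bar> \<le> M"
  shows "set_integrable lborel \<Omega> g"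
proof (rule set_integrable_bound[OF set_integral_const(1)[of M]])
  show "set_borel_measurable lborel \<Omega> g"
    using set_borel_measurable_continuous_open[OF open_\<Omega> assms(1)] by (simp add: set_borel_measurable_def)
qed (use assms(2) in fastforce)

lemma line_holomorphic:
  assumes f: "holo_on f \<Omega>"
  shows "(\<lambda>l. f (l *s z)) holomorphic_on {l. l *s z \<in> \<Omega>}"
    and "open {l. l *s z \<in> \<Omega>}"
    and "z \<in> \<Omega> \<Longrightarrow> cball 0 1 \<subseteq> {l. l *s z \<in> \<Omega>}"
    and "deriv (\<lambda>l. f (l *s z)) 0 = fderiv f 0 z"
proof -
  have d: "((\<lambda>l. f (l *s z)) has_field_derivative fderiv f (l *s z) z) (at l)" if "l *s z \<in> \<Omega>" for l
    using holo_on_line[OF f, of 0 l z] that by simp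
  show "(\<lambda>l. f (l *s z)) holomorphic_on {l. l *s z \<in> \<Omega>}"
    by (rule holomorphic_onI, rule field_differentiable_at_within)
      (auto simp: field_differentiable_def intro!: exI d)
  have "{l. l *s z \<in> \<Omega>} = (\<lambda>l. l *s z) -` \<Omega>" by auto
  then show "open {l. l *s z \<in> \<Omega>}"
    using open_\<Omega> by (auto intro!: open_vimage continuous_intros)
  show "z \<in> \<Omega> \<Longrightarrow> cball 0 1 \<subseteq> {l. l *s z \<in> \<Omega>}"
    using complete_circularD[OF circular] by auto
  show "deriv (\<lambda>l. f (l *s z)) 0 = fderiv f 0 z"
    using DERIV_imp_deriv[OF d[of 0]] zero_in by simp
qed

lemma A_spaceD: "f \<in> A_space p \<Omega> \<Longrightarrow> holo_on f \<Omega>" "f \<in> A_space p \<Omega> \<Longrightarrow> set_integrable lborel \<Omega> (\<lambda>z. cmod (f z) powr p)"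
  by (auto simp: A_space_def)

lemma p_integral_ge_center:
  assumes f: "f \<in> A_space p \<Omega>" and p: "p > 0"
  shows "vol * cmod (f 0) powr p \<le> p_integral p \<Omega> f"
proof -
  note h = A_spaceD[OF f]
  have "(LINT z:\<Omega>|lborel. cmod (f 0) powr p) \<le> p_integral p \<Omega> f"
  proof (rule circular_integral_mono[OF open_\<Omega> circular _ h(2) set_integral_const(1)])
    show "continuous_on \<Omega> (\<lambda>z. cmod (f z) powr p)"
      using p holo_on_imp_continuous_on[OF h(1)] by (rule powr_continuous_on[rotated])
    fix z assume z: "z \<in> \<Omega>"
    show "cmod (f 0) powr p \<le> integral {0..1} (\<lambda>t. cmod (f (circ t *s z)) powr p)"
      using power_sub_mean_value[OF line_holomorphic(1,2)[OF h(1)] line_holomorphic(3)[OF h(1) z] p] by simp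
  qed
  then show ?thesis by (simp add: set_integral_const)
qed

lemma linear_bounded_on: 
  assumes "linear L" obtains M where "\<And>z. z \<in> \<Omega> \<Longrightarrow> cmod (L z) \<le> (M::real)" "M \<ge> 0"
proof -
  obtain B where "\<And>x. norm (L x) \<le> norm x * B" "B > 0"
    using linear_bounded_pos[OF assms] by (metis mult.commute)
  moreover obtain C where "\<And>x. x \<in> \<Omega> \<Longrightarrow> norm x \<le> C" "C > 0"
    using bounded_\<Omega> bounded_pos by metis
  ultimately show ?thesis
    using that[of "C * B"] by (meson less_imp_le mult_nonneg_nonneg mult_right_mono order_trans)
qed

lemma p_integral_fderiv_le:
  assumes f: "f \<in> A_space p \<Omega>" and p: "p > 0" and f0: "f 0 = 0"
  shows "p_integral p \<Omega> (fderiv f 0) \<le> p_integral p \<Omega> f"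
proof -
  note h = A_spaceD[OF f]
  have lin: "linear (fderiv f 0)"
    using holo_on_has_derivative[OF h(1) zero_in] has_derivative_linear by blast
  obtain M where M: "\<And>z. z \<in> \<Omega> \<Longrightarrow> cmod (fderiv f 0 z) \<le> M" "M \<ge> 0"
    using linear_bounded_on[OF lin] by metis
  show ?thesis
  proof (rule circular_integral_mono[OF open_\<Omega> circular _ h(2)])
    show "continuous_on \<Omega> (\<lambda>z. cmod (f z) powr p)"
      using p holo_on_imp_continuous_on[OF h(1)] by (rule powr_continuous_on[rotated])
    have "continuous_on \<Omega> (\<lambda>z. cmod (fderiv f 0 z) powr p)"
      using lin by (intro powr_continuous_on p linear_continuous_on) (simp add: linear_conv_bounded_linear)
    then show "set_integrable lborel \<Omega> (\<lambda>z. cmod (fderiv f 0 z) powr p)"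
      by (rule set_integrable_bounded[where M = "M powr p"]) (use M p in \<open>auto intro: powr_mono2\<close>)
    fix z assume z: "z \<in> \<Omega>"
    let ?U = "{l. l *s z \<in> \<Omega>}" and ?g = "\<lambda>l. f (l *s z)"
    note L = line_holomorphic(1,2,4)[OF h(1), of z] line_holomorphic(3)[OF h(1) z]
    \<comment> \<open>As f vanishes at 0, dividing by l puts the derivative in place of the value at
      0 and leaves the modulus on the unit circle unchanged.\<close>
    define k where "k l = (if l = 0 then deriv ?g 0 else (?g l - ?g 0) / (l - 0))" for l
    have k: "k holomorphic_on ?U"
      unfolding k_def by (rule pole_lemma_open[OF L(1,2)])
    have "cmod (k 0) powr p \<le> integral {0..1} (\<lambda>t. cmod (k (circ t)) powr p)"
      by (rule power_sub_mean_value[OF k L(2,4) p])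
    moreover have "cmod (k (circ t)) = cmod (f (circ t *s z))" for t
      by (simp add: k_def f0 norm_divide)
    ultimately show "cmod (fderiv f 0 z) powr p \<le> integral {0..1} (\<lambda>t. cmod (f (circ t *s z)) powr p)"
      by (simp add: k_def L(3))
  qed
qed

text \<open>Orthogonality on every complex line through 0, integrated over \<Omega>. Integrability
  of |R|^2 is settled first, because the averaging argument is applied to |f|^2 - |R|^2.\<close>

lemma A2_remainder:
  assumes f: "f \<in> A_space 2 \<Omega>"
  defines "R \<equiv> \<lambda>z. f z - f 0 - fderiv f 0 z"
  shows "R \<in> A_space 2 \<Omega>"
    and "vol * (cmod (f 0))\<^sup>2 + p_integral 2 \<Omega> (fderiv f 0) + p_integral 2 \<Omega> R \<le> p_integral 2 \<Omega> f"
proof -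
  note h = A_spaceD[OF f]
  have pow2: "cmod w powr 2 = (cmod w)\<^sup>2" for w by simp
  have lin: "linear (fderiv f 0)"
    using holo_on_has_derivative[OF h(1) zero_in] has_derivative_linear by blast
  have sc: "fderiv f 0 (c *s v) = c * fderiv f 0 v" for c v
    by (rule holo_on_fderiv_scale[OF h(1) zero_in])
  obtain M where M: "\<And>z. z \<in> \<Omega> \<Longrightarrow> cmod (fderiv f 0 z) \<le> M" "M \<ge> 0"
    using linear_bounded_on[OF lin] by metis
  have hl: "holo_on (fderiv f 0) \<Omega>"
    by (rule holo_onI[where D = "\<lambda>_. fderiv f 0"]) (use lin sc in \<open>auto simp: linear_imp_has_derivative\<close>)
  have R: "holo_on R \<Omega>"
    unfolding R_def by (intro holo_on_diff h(1) holo_on_const hl)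
  have cont: "continuous_on \<Omega> (\<lambda>z. (cmod (q z))\<^sup>2)" if "holo_on q \<Omega>" for q
    by (intro continuous_intros holo_on_imp_continuous_on[OF that])
  have fi: "set_integrable lborel \<Omega> (\<lambda>z. (cmod (f z))\<^sup>2)"
    using h(2) by simp
  have li: "set_integrable lborel \<Omega> (\<lambda>z. (cmod (fderiv f 0 z))\<^sup>2)"
    by (rule set_integrable_bounded[OF cont[OF hl], where M = "M\<^sup>2"]) (use M in \<open>auto intro: power_mono\<close>)
  have Ri: "set_integrable lborel \<Omega> (\<lambda>z. (cmod (R z))\<^sup>2)"
  proof (rule set_integrable_bound[where f = "\<lambda>z. 3 * ((cmod (f z))\<^sup>2 + (cmod (f 0))\<^sup>2 + (cmod (fderiv f 0 z))\<^sup>2)"])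
    show "set_integrable lborel \<Omega> (\<lambda>z. 3 * ((cmod (f z))\<^sup>2 + (cmod (f 0))\<^sup>2 + (cmod (fderiv f 0 z))\<^sup>2))"
      by (intro set_integrable_mult_right set_integral_add fi li set_integral_const)
    show "set_borel_measurable lborel \<Omega> (\<lambda>z. (cmod (R z))\<^sup>2)"
      using set_borel_measurable_continuous_open[OF open_\<Omega> cont[OF R]] by (simp add: set_borel_measurable_def)
    have "(cmod (R z))\<^sup>2 \<le> 3 * ((cmod (f z))\<^sup>2 + (cmod (f 0))\<^sup>2 + (cmod (fderiv f 0 z))\<^sup>2)" for z
    proof -
      have "cmod (R z) \<le> cmod (f z) + cmod (f 0) + cmod (fderiv f 0 z)"
        unfolding R_def by (intro order_trans[OF norm_triangle_ineq4] add_right_mono norm_triangle_ineq4)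
      then have "(cmod (R z))\<^sup>2 \<le> (cmod (f z) + cmod (f 0) + cmod (fderiv f 0 z))\<^sup>2"
        by (intro power_mono) auto
      \<comment> \<open>The two sides differ by the sum of the squared differences of the three
        terms.\<close>
      also have "\<dots> \<le> 3 * ((cmod (f z))\<^sup>2 + (cmod (f 0))\<^sup>2 + (cmod (fderiv f 0 z))\<^sup>2)"
        using sum_squares_ge_zero[of "cmod (f z) - cmod (f 0)" "cmod (f z) - cmod (fderiv f 0 z)"]
          zero_le_power2[of "cmod (f 0) - cmod (fderiv f 0 z)"]
        by (simp add: power2_eq_square algebra_simps)
      finally show ?thesis .
    qed
    then show "AE z in lborel. z \<in> \<Omega> \<longrightarrow> norm ((cmod (R z))\<^sup>2) \<le> norm (3 * ((cmod (f z))\<^sup>2 + (cmod (f 0))\<^sup>2 + (cmod (fderiv f 0 z))\<^sup>2))"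
      by (auto intro: order_trans[OF _ abs_ge_self])
  qed
  then show "R \<in> A_space 2 \<Omega>"
    using R by (simp add: A_space_def)
  have "(LINT z:\<Omega>|lborel. (cmod (f 0))\<^sup>2 + (cmod (fderiv f 0 z))\<^sup>2) \<le> (LINT z:\<Omega>|lborel. (cmod (f z))\<^sup>2 - (cmod (R z))\<^sup>2)"
  proof (rule circular_integral_mono[OF open_\<Omega> circular])
    show "continuous_on \<Omega> (\<lambda>z. (cmod (f z))\<^sup>2 - (cmod (R z))\<^sup>2)"
      by (intro continuous_on_diff cont h R)
    show "set_integrable lborel \<Omega> (\<lambda>z. (cmod (f z))\<^sup>2 - (cmod (R z))\<^sup>2)"
      by (intro set_integral_diff fi Ri)
    show "set_integrable lborel \<Omega> (\<lambda>z. (cmod (f 0))\<^sup>2 + (cmod (fderiv f 0 z))\<^sup>2)"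
      by (intro set_integral_add li set_integral_const)
    fix z assume z: "z \<in> \<Omega>"
    note L = line_holomorphic(1,2)[OF h(1), of z] line_holomorphic(3)[OF h(1) z]
    from integral_unique[OF circle_orthogonality[OF L]]
    show "(cmod (f 0))\<^sup>2 + (cmod (fderiv f 0 z))\<^sup>2 \<le> integral {0..1} (\<lambda>t. (cmod (f (circ t *s z)))\<^sup>2 - (cmod (R (circ t *s z)))\<^sup>2)"
      by (simp add: line_holomorphic(4)[OF h(1)] R_def sc mult.commute)
  qed
  then show "vol * (cmod (f 0))\<^sup>2 + p_integral 2 \<Omega> (fderiv f 0) + p_integral 2 \<Omega> R \<le> p_integral 2 \<Omega> f"
    unfolding pow2 using fi Ri li by (simp add: set_integral_add set_integral_diff set_integral_const)
qed

text \<open>Translation carries the ball of radius d / 2 around z to the origin and reduces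
  evaluation at z to evaluation at the centre of a circular domain. The constant is the volume of
  that ball, the same for all f and z.\<close>

lemma local_bound:
  assumes "p > 0"
  obtains C e where "C > 0" "e > 0" "ball 0 e \<subseteq> \<Omega>"
    "\<And>f z. f \<in> A_space p \<Omega> \<Longrightarrow> z \<in> ball 0 e \<Longrightarrow> C * cmod (f z) powr p \<le> p_integral p \<Omega> f"
proof -
  obtain d where d: "d > 0" "ball 0 d \<subseteq> \<Omega>"
    using open_\<Omega> zero_in open_contains_ball by blast
  let ?B = "ball (0 :: complex ^ 'n) (d / 2)"
  interpret B: circular_domain ?B
  proof
    show "complete_circular ?B"
    proof -
      have "norm (t *s z) < d / 2" if "norm z < d / 2" "cmod t \<le> 1" for t :: complex and z :: "complex ^ 'n"
        using that mult_left_le_one_le[of "norm z" "cmod t"] by (simp add: norm_vector_scalar_mult)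
      then show ?thesis by (auto simp: complete_circular_def dist_norm)
    qed
  qed (use d in auto)
  show ?thesis
  proof (rule that[OF B.vol_pos, of "d / 2"])
    fix f z assume f: "f \<in> A_space p \<Omega>" and z: "z \<in> ?B"
    note h = A_spaceD[OF f]
    let ?T = "ball z (d / 2)"
    have T: "?T \<subseteq> \<Omega>"
    proof
      fix w assume "w \<in> ?T"
      then have "dist 0 w < d / 2 + d / 2"
        using z dist_triangle_less_add[of 0 z "d / 2" w "d / 2"] by (auto simp: dist_commute)
      then show "w \<in> \<Omega>" using d by auto
    qed
    have tr: "(\<lambda>w. z + w) ` ?B = ?T"
      using image_add_ball[of z 0 "d/2"] by simp
    have "?B \<subseteq> (\<lambda>w. z + w) -` \<Omega>"
      using T tr by blast
    then have hf: "holo_on (\<lambda>w. f (z + w)) ?B"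
      by (rule holo_on_subset[OF holo_on_translate[OF h(1)]])
    have i1: "set_integrable lborel ?T (\<lambda>w. cmod (f w) powr p)"
      by (rule set_integrable_subset[OF h(2) _ T]) auto
    have c1: "continuous_on ?T (\<lambda>w. cmod (f w) powr p)"
      by (intro powr_continuous_on assms continuous_on_subset[OF holo_on_imp_continuous_on[OF h(1)] T])
    have i2: "set_integrable lborel ?B (\<lambda>w. cmod (f (z + w)) powr p)" "p_integral p ?B (\<lambda>w. f (z + w)) = p_integral p ?T f"
      using set_integral_translate[OF _ _ tr c1] i1 by auto
    have "B.vol * cmod (f z) powr p \<le> p_integral p ?B (\<lambda>w. f (z + w))"
      using B.p_integral_ge_center[of "\<lambda>w. f (z + w)" p] hf i2(1) assms by (simp add: A_space_def)
    also have "\<dots> = p_integral p ?T f" by (rule i2(2))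
    also have "\<dots> \<le> p_integral p \<Omega> f"
      unfolding set_lebesgue_integral_def
      by (rule integral_mono) (use i1 h(2) T in \<open>auto simp: set_integrable_def indicator_def\<close>)
    finally show "B.vol * cmod (f z) powr p \<le> p_integral p \<Omega> f" .
  qed (use d in auto)
qed

text \<open>The constants are fixed before R and r. The evaluation bound controls R on the circle
  |l| = d, the double zero along X brings the factor r^2 / d^2, and squaring gives r^4.\<close>

lemma double_zero_bound:
  obtains C d where "C \<ge> 0" "d > 0" "\<And>l. cmod l \<le> d \<Longrightarrow> l *s X \<in> \<Omega>"
    "\<And>R r. R \<in> A_space 2 \<Omega> \<Longrightarrow> R 0 = 0 \<Longrightarrow> fderiv R 0 X = 0 \<Longrightarrow> 0 \<le> r \<Longrightarrow> r \<le> d \<Longrightarrow>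
      (cmod (R (of_real r *s X)))\<^sup>2 \<le> C * r ^ 4 * p_integral 2 \<Omega> R"
proof -
  obtain C e where C: "C > 0" "e > 0" "ball 0 e \<subseteq> \<Omega>"
    "\<And>f z. f \<in> A_space 2 \<Omega> \<Longrightarrow> z \<in> ball 0 e \<Longrightarrow> C * cmod (f z) powr 2 \<le> p_integral 2 \<Omega> f"
    using local_bound[of 2] by auto
  obtain d where d: "d > 0" "d * norm X < e"
    using small_multiple[OF C(2) norm_ge_zero] by blast
  have inb: "l *s X \<in> ball 0 e" if "cmod l \<le> d" for l
    using that d(2) mult_right_mono[OF that, of "norm X"] by (simp add: norm_vector_scalar_mult)
  show ?thesis
  proof (rule that[of "1 / C / d ^ 4" d])
    fix R r assume R: "R \<in> A_space 2 \<Omega>" "R 0 = 0" "fderiv R 0 X = 0" and r: "0 \<le> r" "r \<le> d"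
    note h = A_spaceD[OF R(1)]
    let ?M = "sqrt (p_integral 2 \<Omega> R / C)"
    have "cmod (R (of_real r *s X)) \<le> (cmod (of_real r))\<^sup>2 / d\<^sup>2 * ?M"
    proof (rule quadratic_bound_of_double_zero[OF line_holomorphic(1,2)[OF h(1), of X]])
      show "cball 0 d \<subseteq> {l. l *s X \<in> \<Omega>}" using inb C(3) by auto
      fix l assume "cmod l = d"
      then have "C * cmod (R (l *s X)) powr 2 \<le> p_integral 2 \<Omega> R"
        using C(4)[OF R(1) inb] by simp
      then show "cmod (R (l *s X)) \<le> ?M"
        using C(1) by (intro real_le_rsqrt) (simp add: field_simps)
    qed (use d r R(2,3) in \<open>simp_all add: line_holomorphic(4)[OF h(1)]\<close>)
    then have "(cmod (R (of_real r *s X)))\<^sup>2 \<le> (r\<^sup>2 / d\<^sup>2 * ?M)\<^sup>2"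
      using r by (intro power_mono) auto
    also have "\<dots> = 1 / C / d ^ 4 * r ^ 4 * p_integral 2 \<Omega> R"
      using C(1) p_integral_nonneg[of \<Omega> R 2]
      by (simp add: power_mult_distrib power_divide real_sqrt_pow2)
    finally show "(cmod (R (of_real r *s X)))\<^sup>2 \<le> 1 / C / d ^ 4 * r ^ 4 * p_integral 2 \<Omega> R" .
  qed (use C d inb in auto)
qed

end

subsection \<open>Linear forms and the Bergman metric at the origin\<close>

definition lin_form :: "complex ^ 'n \<Rightarrow> complex ^ 'n \<Rightarrow> complex" where
  "lin_form a z = (\<Sum>j\<in>UNIV. a $ j * z $ j)"

lemma lin_form_smult_right: "lin_form a (c *s z) = c * lin_form a z"
  by (simp add: lin_form_def sum_distrib_left algebra_simps)

lemma lin_form_smult_left: "lin_form (c *s a) z = c * lin_form a z"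
  by (simp add: lin_form_def sum_distrib_left algebra_simps)

lemma lin_form_zero [simp]: "lin_form 0 z = 0" "lin_form a 0 = 0"
  by (simp_all add: lin_form_def)

lemma linear_lin_form: "linear (lin_form a)"
  by (rule linearI) (auto simp: lin_form_def sum.distrib algebra_simps scaleR_sum_right)

lemma lin_form_has_derivative: "(lin_form a has_derivative lin_form a) (at z)"
  by (simp add: linear_imp_has_derivative linear_lin_form)

lemma fderiv_lin_form: "fderiv (lin_form a) z = lin_form a"
  by (rule has_derivative_imp_fderiv[OF lin_form_has_derivative])

lemma holo_on_lin_form: "holo_on (lin_form a) \<Omega>"
  by (rule holo_onI[where D = "\<lambda>_. lin_form a"]) (auto intro: lin_form_has_derivative simp: lin_form_smult_right)

text \<open>Conjugate coefficients give a form that does not vanish at a nonzero X; the positivity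
  of the integrals of linear forms and of the metric rests on it.\<close>

lemma lin_form_cnj: "lin_form (\<chi> j. cnj (X $ j)) X = of_real ((norm X)\<^sup>2)"
proof -
  have "of_real ((norm X)\<^sup>2) = (\<Sum>j\<in>UNIV. complex_of_real ((cmod (X $ j))\<^sup>2))"
    by (simp add: norm_vec_def L2_set_def sum_nonneg)
  also have "\<dots> = (\<Sum>j\<in>UNIV. X $ j * cnj (X $ j))"
    by (simp only: complex_norm_square)
  finally show ?thesis
    by (simp add: lin_form_def mult.commute)
qed

lemma norm_lin_form_le: "cmod (lin_form a z) \<le> real CARD('n) * (norm a * norm (z :: complex ^ 'n))"
proof -
  have "cmod (lin_form a z) \<le> (\<Sum>j\<in>(UNIV :: 'n set). norm a * norm z)"
    unfolding lin_form_def
    by (rule sum_norm_le) (auto simp: norm_mult intro!: mult_mono Finite_Cartesian_Product.norm_nth_le)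
  then show ?thesis by simp
qed

lemma fderiv_eq_lin_form:
  assumes "holo_on f \<Omega>" "z \<in> \<Omega>"
  shows "fderiv f z = lin_form (\<chi> j. fderiv f z (axis j 1))"
  by (rule ext, subst fderiv_eq_sum[OF assms]) (simp add: lin_form_def mult.commute)

lemma dir_deriv_eq_fderiv:
  assumes f: "holo_on f \<Omega>" "z \<in> \<Omega>"
  shows "dir_deriv X f z = fderiv f z X"
proof -
  have "partial_z j f z = fderiv f z (axis j 1)" for j
  proof -
    have "((\<lambda>l. f (z + l *s axis j 1)) has_field_derivative fderiv f z (axis j 1)) (at (z $ j - z $ j))"
      using holo_on_line[of f \<Omega> z 0] f by simp
    then have "((\<lambda>w. f (z + (w - z $ j) *s axis j 1)) has_field_derivative fderiv f z (axis j 1)) (at (z $ j))"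
      using DERIV_chain2[where g = "\<lambda>w. w - z $ j" and f = "\<lambda>l. f (z + l *s axis j 1)" and x = "z $ j"]
      by (force intro!: derivative_eq_intros)
    moreover have "z + (w - z $ j) *s axis j 1 = (\<chi> k. if k = j then w else z $ k)" for w
      by (simp add: vec_eq_iff axis_def)
    ultimately show ?thesis
      unfolding partial_z_def by (simp add: DERIV_imp_deriv)
  qed
  then show ?thesis
    unfolding dir_deriv_def by (subst fderiv_eq_sum[OF f]) simp
qed

text \<open>The graph of t^s lies above its tangent at t = 1. This is Young's inequality for t and 1
  with the conjugate exponents s and s / (s - 1).\<close>

lemma bernoulli_powr:
  assumes "s > 1" "t \<ge> (0::real)"
  shows "1 + s * (t - 1) \<le> t powr s"
proof -
  have "t * 1 \<le> t powr s / s + 1 powr (s / (s - 1)) / (s / (s - 1))"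
    by (rule Youngs_inequality) (use assms in \<open>auto simp: field_simps\<close>)
  then have "s * t \<le> s * (t powr s / s + (s - 1) / s)"
    using assms by (intro mult_left_mono) auto
  also have "\<dots> = t powr s + (s - 1)"
    using assms by (simp add: distrib_left)
  finally show ?thesis
    by (simp add: algebra_simps)
qed

context circular_domain
begin

section \<open>Power means of linear forms\<close>

lemma bounded_norm: obtains C where "C > 0" "\<And>z. z \<in> \<Omega> \<Longrightarrow> norm z \<le> C"
  using bounded_\<Omega> bounded_pos by metis

lemma continuous_on_lin_form_powr: "p > 0 \<Longrightarrow> continuous_on \<Omega> (\<lambda>z. cmod (lin_form a z) powr p)"
  by (intro powr_continuous_on holo_on_imp_continuous_on holo_on_lin_form)

lemma lin_form_A_space:
  assumes "p > 0"
  shows "lin_form a \<in> A_space p \<Omega>"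
proof -
  obtain C where C: "C > 0" "\<And>z. z \<in> \<Omega> \<Longrightarrow> norm z \<le> C"
    using bounded_norm by blast
  have "cmod (lin_form a z) powr p \<le> (real CARD('n) * (norm a * C)) powr p" if "z \<in> \<Omega>" for z
    using C(2)[OF that] assms
    by (intro powr_mono2 order_trans[OF norm_lin_form_le] mult_left_mono) auto
  then show ?thesis
    unfolding A_space_def using holo_on_lin_form
    by (auto intro!: set_integrable_bounded[OF continuous_on_lin_form_powr[OF assms]])
qed

lemma p_integral_lin_form_pos:
  assumes p: "p > 0" and a: "a \<noteq> 0"
  shows "p_integral p \<Omega> (lin_form a) > 0"
proof -
  let ?b = "\<chi> j. cnj (a $ j)"
  obtain e where e: "e > 0" "ball 0 e \<subseteq> \<Omega>"
    using open_\<Omega> zero_in open_contains_ball by blast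
  obtain r where r: "r > 0" "r * norm ?b < e"
    using small_multiple[OF e(1) norm_ge_zero] by blast
  have in\<Omega>: "of_real r *s ?b \<in> \<Omega>"
    using r e by (intro subsetD[OF e(2)]) (simp add: norm_vector_scalar_mult)
  have "lin_form a ?b = of_real ((norm a)\<^sup>2)"
    using lin_form_cnj[of a] by (simp add: lin_form_def mult.commute)
  then have "cmod (lin_form a (of_real r *s ?b)) powr p > 0"
    using r(1) a by (simp add: lin_form_smult_right)
  then show ?thesis
    by (intro set_integral_pos[OF open_\<Omega> continuous_on_lin_form_powr[OF p] A_spaceD(2)[OF lin_form_A_space[OF p]] _ in\<Omega>]) auto
qed

text \<open>Division by \<open>vol\<close> normalises to a probability measure, for which power
  means increase with the exponent.\<close>

definition lin_mean :: "real \<Rightarrow> complex ^ 'n \<Rightarrow> real" where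
  "lin_mean p a = (p_integral p \<Omega> (lin_form a) / vol) powr (1 / p)"

lemma lin_mean_pos: "p > 0 \<Longrightarrow> a \<noteq> 0 \<Longrightarrow> lin_mean p a > 0"
  using p_integral_lin_form_pos[of p a] vol_pos by (simp add: lin_mean_def)

text \<open>The inequality is strict because the integrand of the difference is positive at the origin,
  where the linear form vanishes.\<close>

lemma lin_mean_less:
  assumes pq: "0 < p" "p < q" and a: "a \<noteq> 0"
  shows "lin_mean p a < lin_mean q a"
proof -
  define s where "s = q / p"
  have s: "s > 1" "p * s = q" using pq by (auto simp: s_def)
  define m where "m = p_integral p \<Omega> (lin_form a) / vol"
  have m: "m > 0" using p_integral_lin_form_pos[OF pq(1) a] vol_pos by (simp add: m_def)
  let ?l = "\<lambda>r z. cmod (lin_form a z) powr r"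
  have q: "q > 0" using pq by simp
  note ip = A_spaceD(2)[OF lin_form_A_space[OF pq(1)], of a]
  note iq = A_spaceD(2)[OF lin_form_A_space[OF q], of a]
  \<comment> \<open>The gap in \<open>bernoulli_powr\<close> at t = |a(z)|^p / m. The choice of m
    gives t mean 1, so the tangent 1 + s (t - 1) integrates to \<open>vol\<close>.\<close>
  define g where "g z = ?l q z / m powr s - (1 - s + s / m * ?l p z)" for z
  have g: "g z = (?l p z / m) powr s - (1 + s * (?l p z / m - 1))" for z
    using m by (simp add: g_def powr_divide powr_powr s(2) algebra_simps)
  have "(LINT z:\<Omega>|lborel. g z) > 0"
  proof (rule set_integral_pos[OF open_\<Omega>, where ?z0.0 = 0])
    show "continuous_on \<Omega> g"
      unfolding g_def using m by (intro continuous_intros continuous_on_lin_form_powr pq(1) q) auto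
    show "set_integrable lborel \<Omega> g"
      unfolding g_def
      by (intro set_integral_diff set_integral_add set_integrable_divide set_integrable_mult_right set_integral_const ip iq)
    show "g z \<ge> 0" for z
      unfolding g using bernoulli_powr[OF s(1), of "?l p z / m"] m by simp
    show "g 0 > 0"
      using s by (simp add: g_def)
  qed (rule zero_in)
  also have "(LINT z:\<Omega>|lborel. g z) = (LINT z:\<Omega>|lborel. ?l q z / m powr s) - (vol * (1 - s) + (LINT z:\<Omega>|lborel. s / m * ?l p z))"
    unfolding g_def
    by (subst set_integral_diff set_integral_add, (intro set_integral_add set_integral_diff set_integrable_divide set_integrable_mult_right set_integral_const ip iq)+)+
      (simp add: set_integral_const right_diff_distrib)
  also have "(LINT z:\<Omega>|lborel. s / m * ?l p z) = vol * s"
    using m vol_pos by (auto simp: m_def)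
  also have "(LINT z:\<Omega>|lborel. ?l q z / m powr s) - (vol * (1 - s) + vol * s) = p_integral q \<Omega> (lin_form a) / m powr s - vol"
    by (simp add: right_diff_distrib)
  finally have "m powr s < p_integral q \<Omega> (lin_form a) / vol"
    using vol_pos m by (simp add: field_simps)
  then have "(m powr s) powr (1 / q) < (p_integral q \<Omega> (lin_form a) / vol) powr (1 / q)"
    using q m by (intro powr_less_mono2) auto
  moreover have "(m powr s) powr (1 / q) = m powr (1 / p)"
    using pq by (simp add: powr_powr s_def)
  ultimately show ?thesis
    by (simp add: lin_mean_def m_def)
qed

text \<open>Dominated convergence; unit coefficient vectors and the boundedness of \<Omega> give one
  constant majorant.\<close>

lemma p_integral_lin_form_continuous:
  assumes p: "p > 0"
  shows "continuous_on (sphere 0 1) (\<lambda>a. p_integral p \<Omega> (lin_form a))"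
  unfolding continuous_on_sequentially
proof (intro allI ballI impI)
  fix x and a assume x: "(\<forall>n. x n \<in> sphere 0 1) \<and> x \<longlonglongrightarrow> (a :: complex ^ 'n)"
  obtain C where C: "C > 0" "\<And>z. z \<in> \<Omega> \<Longrightarrow> norm z \<le> C"
    using bounded_norm by blast
  let ?B = "(real CARD('n) * C) powr p"
  have meas: "(\<lambda>z. indicator \<Omega> z *\<^sub>R cmod (lin_form b z) powr p) \<in> borel_measurable lborel" for b
    using set_borel_measurable_continuous_open[OF open_\<Omega> continuous_on_lin_form_powr[OF p], of b]
    by (simp add: set_borel_measurable_def)
  have "(\<lambda>n. \<integral>z. indicator \<Omega> z *\<^sub>R cmod (lin_form (x n) z) powr p \<partial>lborel) \<longlonglongrightarrow> (\<integral>z. indicator \<Omega> z *\<^sub>R cmod (lin_form a z) powr p \<partial>lborel)"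
  proof (rule integral_dominated_convergence[where w = "\<lambda>z. indicator \<Omega> z *\<^sub>R ?B"])
    show "integrable lborel (\<lambda>z. indicator \<Omega> z *\<^sub>R ?B)"
      using set_integral_const(1)[of ?B] by (simp add: set_integrable_def)
    show "AE z in lborel. (\<lambda>n. indicator \<Omega> z *\<^sub>R cmod (lin_form (x n) z) powr p) \<longlonglongrightarrow> indicator \<Omega> z *\<^sub>R cmod (lin_form a z) powr p"
      unfolding lin_form_def using x p
      by (intro AE_I2 tendsto_intros tendsto_powr') (auto intro!: tendsto_intros)
    show "AE z in lborel. norm (indicator \<Omega> z *\<^sub>R cmod (lin_form (x n) z) powr p) \<le> indicator \<Omega> z *\<^sub>R ?B" for n
    proof (rule AE_I2)
      fix z
      have "cmod (lin_form (x n) z) powr p \<le> ?B" if "z \<in> \<Omega>"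
        using norm_lin_form_le[of "x n" z] x C(2)[OF that] p
        by (intro powr_mono2) (auto intro: order_trans mult_left_mono)
      then show "norm (indicator \<Omega> z *\<^sub>R cmod (lin_form (x n) z) powr p) \<le> indicator \<Omega> z *\<^sub>R ?B"
        by (auto simp: indicator_def)
    qed
  qed (use meas in auto)
  then show "((\<lambda>a. p_integral p \<Omega> (lin_form a)) \<circ> x) \<longlonglongrightarrow> p_integral p \<Omega> (lin_form a)"
    by (simp add: o_def set_lebesgue_integral_def)
qed

lemma lin_mean_smult:
  assumes "p > 0"
  shows "lin_mean p (c *s a) = cmod c * lin_mean p a"
proof -
  have "p_integral p \<Omega> (lin_form (c *s a)) = cmod c powr p * p_integral p \<Omega> (lin_form a)"
    by (simp add: lin_form_smult_left norm_mult powr_mult)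
  then have "lin_mean p (c *s a) = (cmod c powr p * (p_integral p \<Omega> (lin_form a) / vol)) powr (1 / p)"
    by (simp add: lin_mean_def)
  also have "\<dots> = cmod c * lin_mean p a"
    using assms vol_pos p_integral_nonneg[of \<Omega> "lin_form a" p]
    unfolding lin_mean_def by (subst powr_mult) (simp_all add: powr_powr)
  finally show ?thesis .
qed

text \<open>The quotient does not change when the form is scaled, so it suffices to maximise a
  continuous function on the compact unit sphere.\<close>

lemma lin_ratio_attains:
  assumes p: "p > 0"
  obtains a where "a \<noteq> 0" "\<And>b. b \<noteq> 0 \<Longrightarrow> cmod (lin_form b X) / lin_mean p b \<le> cmod (lin_form a X) / lin_mean p a"
proof -
  let ?f = "\<lambda>a. cmod (lin_form a X) / lin_mean p a"
  have nz: "a \<noteq> 0" if "a \<in> sphere 0 (1::real)" for a :: "complex ^ 'n"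
    using that by auto
  have "continuous_on (sphere 0 1) ?f"
    unfolding lin_mean_def
    using p_integral_lin_form_pos[OF p nz] vol_pos
    by (intro continuous_intros p_integral_lin_form_continuous[OF p]) (auto simp: lin_form_def less_imp_neq[symmetric] intro!: continuous_intros)
  moreover have "axis undefined 1 \<in> sphere (0 :: complex ^ 'n) 1"
    by (simp add: norm_axis_1)
  ultimately obtain a where a: "a \<in> sphere 0 1" "\<And>b. b \<in> sphere 0 1 \<Longrightarrow> ?f b \<le> ?f a"
    using continuous_attains_sup[of "sphere (0 :: complex ^ 'n) 1" ?f] by auto
  show ?thesis
  proof (rule that[OF nz[OF a(1)]])
    fix b :: "complex ^ 'n" assume b: "b \<noteq> 0"
    let ?c = "of_real (inverse (norm b)) :: complex"
    have "?f (?c *s b) \<le> ?f a"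
      using b by (intro a(2)) (simp add: norm_vector_scalar_mult norm_inverse)
    then show "?f b \<le> ?f a"
      using b by (simp add: lin_mean_smult[OF p] lin_form_smult_left norm_mult)
  qed
qed

lemma p_norm_eq_mean: "p > 0 \<Longrightarrow> p_norm p \<Omega> (lin_form a) = vol powr (1 / p) * lin_mean p a"
  using vol_pos p_integral_nonneg[of \<Omega> "lin_form a" p]
  by (simp add: p_norm_def lin_mean_def powr_divide)

section \<open>Suprema in the kernel and the metric as maxima\<close>

lemma p_bergman_kernel_eqI:
  assumes p: "p > 0" and z: "z \<in> \<Omega>"
    and le: "\<And>f. f \<in> A_space p \<Omega> \<Longrightarrow> cmod (f z) powr p \<le> K * p_integral p \<Omega> f" "K \<ge> 0"
    and f: "f \<in> A_space p \<Omega>" "f z \<noteq> 0" "cmod (f z) powr p = K * p_integral p \<Omega> f"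
  shows "p_bergman_kernel p \<Omega> z = K"
  unfolding p_bergman_kernel_def
proof (rule cSup_eq_maximum)
  have "p_integral p \<Omega> f \<noteq> 0"
    using f by auto
  then have "K = cmod (f z) powr p / p_norm p \<Omega> f powr p"
    using f(3) p by (simp add: p_norm_powr)
  then show "K \<in> {cmod (f z) powr p / p_norm p \<Omega> f powr p |f. f \<in> A_space p \<Omega> \<and> (\<exists>w\<in>\<Omega>. f w \<noteq> 0)}"
    using f z by blast
  fix x assume "x \<in> {cmod (f z) powr p / p_norm p \<Omega> f powr p |f. f \<in> A_space p \<Omega> \<and> (\<exists>w\<in>\<Omega>. f w \<noteq> 0)}"
  then obtain h where h: "h \<in> A_space p \<Omega>" "x = cmod (h z) powr p / p_integral p \<Omega> h"
    using p by (auto simp: p_norm_powr)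
  \<comment> \<open>If the integral vanishes, the quotient is 0 by convention and lies below K
    because K is nonnegative.\<close>
  show "x \<le> K"
    using le(1)[OF h(1)] le(2) p_integral_nonneg[of \<Omega> h p]
    by (cases "p_integral p \<Omega> h = 0") (auto simp: h(2) field_simps)
qed

lemma const_A_space: "p > 0 \<Longrightarrow> (\<lambda>z. c) \<in> A_space p \<Omega>"
  by (simp add: A_space_def holo_on_const set_integral_const)

lemma p_bergman_kernel_zero:
  assumes "p > 0"
  shows "p_bergman_kernel p \<Omega> 0 = 1 / vol"
  by (rule p_bergman_kernel_eqI[OF assms zero_in, where f = "\<lambda>z. 1"])
    (use assms vol_pos p_integral_ge_center const_A_space in \<open>auto simp: field_simps set_integral_const\<close>)

lemma p_bergman_metric_zero:
  assumes p: "p > 0" and a: "a \<noteq> 0"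
    and max: "\<And>b. b \<noteq> 0 \<Longrightarrow> cmod (lin_form b X) / lin_mean p b \<le> cmod (lin_form a X) / lin_mean p a"
  shows "p_bergman_metric p \<Omega> 0 X = cmod (lin_form a X) / lin_mean p a"
proof -
  have v: "vol powr (1 / p) > 0" using vol_pos by simp
  have "Sup {cmod (dir_deriv X f 0) / p_norm p \<Omega> f | f. f \<in> A_space p \<Omega> \<and> f 0 = 0 \<and> p_norm p \<Omega> f > 0}
     = cmod (lin_form a X) / lin_mean p a / vol powr (1 / p)"
  proof (rule cSup_eq_maximum)
    have "dir_deriv X (lin_form a) 0 = lin_form a X"
      using dir_deriv_eq_fderiv[OF holo_on_lin_form zero_in] by (simp add: fderiv_lin_form)
    moreover have "p_norm p \<Omega> (lin_form a) > 0"
      using p a v by (simp add: p_norm_eq_mean lin_mean_pos)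
    ultimately show "cmod (lin_form a X) / lin_mean p a / vol powr (1 / p)
       \<in> {cmod (dir_deriv X f 0) / p_norm p \<Omega> f | f. f \<in> A_space p \<Omega> \<and> f 0 = 0 \<and> p_norm p \<Omega> f > 0}"
      using lin_form_A_space[OF p, of a] p
      by (intro CollectI exI[of _ "lin_form a"]) (simp add: p_norm_eq_mean mult.commute)
  next
    fix x assume "x \<in> {cmod (dir_deriv X f 0) / p_norm p \<Omega> f | f. f \<in> A_space p \<Omega> \<and> f 0 = 0 \<and> p_norm p \<Omega> f > 0}"
    then obtain f where f: "f \<in> A_space p \<Omega>" "f 0 = 0" "p_norm p \<Omega> f > 0" and x: "x = cmod (dir_deriv X f 0) / p_norm p \<Omega> f"
      by blast
    note h = A_spaceD(1)[OF f(1)]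
    define b where "b = (\<chi> j. fderiv f 0 (axis j 1))"
    have b: "fderiv f 0 = lin_form b"
      unfolding b_def by (rule fderiv_eq_lin_form[OF h zero_in])
    have x': "x = cmod (lin_form b X) / p_norm p \<Omega> f"
      unfolding x dir_deriv_eq_fderiv[OF h zero_in] b ..
    show "x \<le> cmod (lin_form a X) / lin_mean p a / vol powr (1 / p)"
    \<comment> \<open>The derivative of f may vanish, whereas the maximality of a only speaks of
      nonzero forms.\<close>
    proof (cases "b = 0")
      case True
      then show ?thesis
        using lin_mean_pos[OF p a] v by (simp add: x')
    next
      case False
      have "p_integral p \<Omega> (lin_form b) \<le> p_integral p \<Omega> f"
        using p_integral_fderiv_le[OF f(1) p f(2)] by (simp add: b)
      then have "p_norm p \<Omega> (lin_form b) \<le> p_norm p \<Omega> f"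
        unfolding p_norm_def using p p_integral_nonneg by (intro powr_mono2) auto
      moreover have "p_norm p \<Omega> (lin_form b) > 0"
        using p False v by (simp add: p_norm_eq_mean lin_mean_pos)
      ultimately have "x \<le> cmod (lin_form b X) / p_norm p \<Omega> (lin_form b)"
        unfolding x' by (intro divide_left_mono) auto
      also have "\<dots> = cmod (lin_form b X) / lin_mean p b / vol powr (1 / p)"
        using p by (simp add: p_norm_eq_mean mult.commute)
      also have "\<dots> \<le> cmod (lin_form a X) / lin_mean p a / vol powr (1 / p)"
        using max[OF False] v by (intro divide_right_mono) auto
      finally show ?thesis .
    qed
  qed
  \<comment> \<open>The kernel factor in the metric cancels the volume factor that relates
    \<open>p_norm\<close> to \<open>lin_mean\<close>.\<close>
  moreover have "(1 / vol) powr (- 1 / p) = vol powr (1 / p)"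
    using vol_pos by (simp add: powr_divide powr_minus_divide)
  ultimately show ?thesis
    unfolding p_bergman_metric_def p_bergman_kernel_zero[OF p] using v by simp
qed

text \<open>The maximiser for the larger exponent q also competes for p, where its mean is strictly
  smaller.\<close>

lemma p_bergman_metric_strict_antimono:
  assumes pq: "0 < p" "p < q" and X: "X \<noteq> 0"
  shows "0 < p_bergman_metric q \<Omega> 0 X" "p_bergman_metric q \<Omega> 0 X < p_bergman_metric p \<Omega> 0 X"
proof -
  have q: "q > 0" using pq by simp
  obtain a where a: "a \<noteq> 0" "\<And>b. b \<noteq> 0 \<Longrightarrow> cmod (lin_form b X) / lin_mean q b \<le> cmod (lin_form a X) / lin_mean q a"
    using lin_ratio_attains[OF q] by blast
  obtain a' where a': "a' \<noteq> 0" "\<And>b. b \<noteq> 0 \<Longrightarrow> cmod (lin_form b X) / lin_mean p b \<le> cmod (lin_form a' X) / lin_mean p a'"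
    using lin_ratio_attains[OF pq(1)] by blast
  \<comment> \<open>The conjugate form makes the maximum positive, so a(X) is nonzero and the strict
    inequality of means survives multiplication by |a(X)|.\<close>
  let ?c = "\<chi> j. cnj (X $ j)"
  have c: "lin_form ?c X \<noteq> 0" using X by (simp add: lin_form_cnj)
  then have c0: "?c \<noteq> 0" by (metis lin_form_zero(1))
  have "0 < cmod (lin_form ?c X) / lin_mean q ?c"
    using c lin_mean_pos[OF q c0] by simp
  also have "\<dots> \<le> cmod (lin_form a X) / lin_mean q a"
    by (rule a(2)[OF c0])
  finally have pos: "0 < cmod (lin_form a X) / lin_mean q a" .
  then show "0 < p_bergman_metric q \<Omega> 0 X"
    using p_bergman_metric_zero[OF q a] by simp
  have "cmod (lin_form a X) / lin_mean q a < cmod (lin_form a X) / lin_mean p a"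
    using pos lin_mean_less[OF pq a(1)] lin_mean_pos[OF pq(1) a(1)]
    by (intro divide_strict_left_mono) (auto simp: zero_less_divide_iff)
  also have "\<dots> \<le> cmod (lin_form a' X) / lin_mean p a'"
    by (rule a'(2)[OF a(1)])
  finally show "p_bergman_metric q \<Omega> 0 X < p_bergman_metric p \<Omega> 0 X"
    using p_bergman_metric_zero[OF q a] p_bergman_metric_zero[OF pq(1) a'] by simp
qed

end

subsection \<open>Kernel and Levi form\<close>

lemma jac_inverse:
  assumes "open S" and F: "holo_map_on F S" "F ` S \<subseteq> T" and G: "holo_map_on G T"
    and inv: "\<And>z. z \<in> S \<Longrightarrow> G (F z) = z" and z: "z \<in> S"
  shows "det (jac G (F z)) * det (jac F z) = 1"
proof -
  have "((\<lambda>z. G (F z)) has_derivative (\<lambda>v. jac G (F z) *v (jac F z *v v))) (at z)"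
    using diff_chain_at[OF holo_map_on_has_derivative[OF F(1) z] holo_map_on_has_derivative[OF G]] F(2) z
    by (auto simp: o_def)
  then have "((\<lambda>z. z) has_derivative (\<lambda>v. jac G (F z) *v (jac F z *v v))) (at z)"
    by (rule has_derivative_transform_within_open[OF _ assms(1) z]) (simp add: inv)
  then have "(\<lambda>v. jac G (F z) *v (jac F z *v v)) = (\<lambda>v. v)"
    by (rule has_derivative_unique) simp
  then have "(jac G (F z) ** jac F z) *v v = mat 1 *v v" for v
    by (metis matrix_vector_mul_assoc matrix_vector_mul_lid)
  then have "jac G (F z) ** jac F z = mat 1"
    by (simp add: matrix_eq)
  then show ?thesis
    by (metis det_mul det_I)
qed

text \<open>By Lagrange's identity the two sides differ by the sum of the squared minors.\<close>

lemma cauchy_schwarz_3: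
  fixes a b c x y z :: real
  shows "(a * x + b * y + c * z)\<^sup>2 \<le> (a\<^sup>2 + b\<^sup>2 + c\<^sup>2) * (x\<^sup>2 + y\<^sup>2 + z\<^sup>2)"
proof -
  have "(a\<^sup>2 + b\<^sup>2 + c\<^sup>2) * (x\<^sup>2 + y\<^sup>2 + z\<^sup>2) - (a * x + b * y + c * z)\<^sup>2
    = (a * y - b * x)\<^sup>2 + (a * z - c * x)\<^sup>2 + (b * z - c * y)\<^sup>2"
    by (simp add: power2_eq_square algebra_simps)
  also have "\<dots> \<ge> 0" by simp
  finally show ?thesis by simp
qed

context circular_domain
begin

section \<open>Automorphisms and the transformation of the kernel\<close>

lemma contractible_\<Omega>: "contractible \<Omega>"
proof (rule starlike_imp_contractible, unfold starlike_def, intro bexI[OF _ zero_in] ballI subsetI)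
  fix x y assume x: "x \<in> \<Omega>" and "y \<in> closed_segment 0 x"
  then obtain u where "0 \<le> u" "u \<le> 1" "y = u *\<^sub>R x"
    by (auto simp: closed_segment_def)
  then show "y \<in> \<Omega>"
    using x by (simp add: scaleR_eq_vector_scalar_mult complete_circularD[OF circular])
qed

text \<open>The weight is a branch of the power \<open>2 / p\<close> of the complex Jacobian.\<close>

lemma jacobian_weight:
  assumes F: "holo_map_on F \<Omega>" "bij_betw F \<Omega> \<Omega>" "\<And>z. z \<in> \<Omega> \<Longrightarrow> det (jac F z) \<noteq> 0" and p: "p > 0"
  obtains h where "\<And>z. z \<in> \<Omega> \<Longrightarrow> cmod (h z) powr p = (cmod (det (jac F z)))\<^sup>2"
    "\<And>f. f \<in> A_space p \<Omega> \<Longrightarrow> (\<lambda>z. f (F z) * h z) \<in> A_space p \<Omega>"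
    "\<And>f. f \<in> A_space p \<Omega> \<Longrightarrow> p_integral p \<Omega> (\<lambda>z. f (F z) * h z) = p_integral p \<Omega> f"
proof -
  obtain g where g: "holo_on g \<Omega>" "\<And>z. z \<in> \<Omega> \<Longrightarrow> det (jac F z) = exp (g z)"
    using holo_on_logarithm[OF holo_on_det_jac[OF F(1) open_\<Omega>] open_\<Omega> contractible_\<Omega> F(3)] by blast
  define h where "h z = exp (of_real (2 / p) * g z)" for z
  have h: "holo_on h \<Omega>"
    unfolding h_def
    by (rule holo_on_compose_field[where g = exp, OF holo_on_mult[OF holo_on_const g(1)]])
      (rule field_differentiable_within_exp)
  have hp: "cmod (h z) powr p = (cmod (det (jac F z)))\<^sup>2" if "z \<in> \<Omega>" for z
  proof -
    have "cmod (h z) powr p = exp (2 * Re (g z))"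
      using p by (simp add: h_def exp_powr_real)
    then show ?thesis
      using g(2)[OF that] by (simp add: exp_double)
  qed
  have im: "F ` \<Omega> = \<Omega>" "inj_on F \<Omega>"
    using F(2) by (auto simp: bij_betw_def)
  have "(\<lambda>z. f (F z) * h z) \<in> A_space p \<Omega> \<and> p_integral p \<Omega> (\<lambda>z. f (F z) * h z) = p_integral p \<Omega> f"
    if f: "f \<in> A_space p \<Omega>" for f
  proof -
    note hf = A_spaceD[OF f]
    have hol: "holo_on (\<lambda>z. f (F z) * h z) \<Omega>"
      using im by (intro holo_on_mult h holo_on_compose_map[OF F(1) hf(1)]) auto
    have "set_integrable lborel \<Omega> (\<lambda>z. (cmod (det (jac F z)))\<^sup>2 * cmod (f (F z)) powr p) \<and>
      (LINT z:\<Omega>|lborel. (cmod (det (jac F z)))\<^sup>2 * cmod (f (F z)) powr p) = p_integral p \<Omega> f"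
      using change_of_variables_holo[OF open_\<Omega> F(1) im(2,1) open_\<Omega>
          powr_continuous_on[OF holo_on_imp_continuous_on[OF hf(1)] p], of "p_integral p \<Omega> f"] hf(2)
      by simp
    moreover have "indicator \<Omega> z *\<^sub>R ((cmod (det (jac F z)))\<^sup>2 * cmod (f (F z)) powr p)
        = indicator \<Omega> z *\<^sub>R cmod (f (F z) * h z) powr p" for z
      by (cases "z \<in> \<Omega>") (simp_all add: norm_mult powr_mult hp)
    ultimately show ?thesis
      using hol by (simp only: A_space_def set_integrable_def set_lebesgue_integral_def mem_Collect_eq simp_thms)
  qed
  then show ?thesis
    using that[of h] hp by blast
qed

text \<open>At a given z one automorphism yields the same constant for every exponent. The bound and
  an extremal function are recorded beside the value because \<open>levi_form_log_kernel\<close>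
  takes the value for p but the other two for exponent 2.\<close>

lemma p_bergman_kernel_homogeneous:
  assumes \<phi>: "biholo_aut \<Omega> \<phi>" "\<phi> z = 0" and z: "z \<in> \<Omega>" and p: "p > 0"
  shows "p_bergman_kernel p \<Omega> z = (cmod (det (jac \<phi> z)))\<^sup>2 / vol"
    and "f \<in> A_space p \<Omega> \<Longrightarrow> cmod (f z) powr p \<le> (cmod (det (jac \<phi> z)))\<^sup>2 / vol * p_integral p \<Omega> f"
    and "\<exists>f\<in>A_space p \<Omega>. f z \<noteq> 0 \<and> cmod (f z) powr p = (cmod (det (jac \<phi> z)))\<^sup>2 / vol * p_integral p \<Omega> f"
proof -
  define \<psi> where "\<psi> = inv_into \<Omega> \<phi>"
  have bij: "bij_betw \<phi> \<Omega> \<Omega>" and h\<phi>: "holo_map_on \<phi> \<Omega>" and h\<psi>: "holo_map_on \<psi> \<Omega>"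
    using \<phi> by (auto simp: biholo_aut_def \<psi>_def)
  have bij': "bij_betw \<psi> \<Omega> \<Omega>"
    unfolding \<psi>_def using bij by (rule bij_betw_inv_into)
  have inv: "\<psi> (\<phi> w) = w" "\<phi> (\<psi> w) = w" if "w \<in> \<Omega>" for w
    using bij that by (auto simp: \<psi>_def bij_betw_inv_into_left bij_betw_inv_into_right)
  have im: "\<phi> ` \<Omega> \<subseteq> \<Omega>" "\<psi> ` \<Omega> \<subseteq> \<Omega>"
    using bij bij' by (auto simp: bij_betw_def)
  have J: "det (jac \<psi> (\<phi> w)) * det (jac \<phi> w) = 1" "det (jac \<phi> (\<psi> w)) * det (jac \<psi> w) = 1" if "w \<in> \<Omega>" for w
    using jac_inverse[OF open_\<Omega> h\<phi> im(1) h\<psi> inv(1) that] jac_inverse[OF open_\<Omega> h\<psi> im(2) h\<phi> inv(2) that] by auto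
  have nz: "det (jac \<phi> w) \<noteq> 0" "det (jac \<psi> w) \<noteq> 0" if "w \<in> \<Omega>" for w
    using J[OF that] by auto
  let ?K = "(cmod (det (jac \<phi> z)))\<^sup>2 / vol"
  show le: "cmod (f z) powr p \<le> ?K * p_integral p \<Omega> f" if f: "f \<in> A_space p \<Omega>" for f
  proof -
    obtain h where h: "\<And>w. w \<in> \<Omega> \<Longrightarrow> cmod (h w) powr p = (cmod (det (jac \<psi> w)))\<^sup>2"
      "\<And>f. f \<in> A_space p \<Omega> \<Longrightarrow> (\<lambda>w. f (\<psi> w) * h w) \<in> A_space p \<Omega>"
      "\<And>f. f \<in> A_space p \<Omega> \<Longrightarrow> p_integral p \<Omega> (\<lambda>w. f (\<psi> w) * h w) = p_integral p \<Omega> f"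
      using jacobian_weight[OF h\<psi> bij' nz(2) p] by blast
    \<comment> \<open>Pulling f back by the inverse map moves its value at z to the origin, where
      the centre estimate applies.\<close>
    have "vol * cmod (f (\<psi> 0) * h 0) powr p \<le> p_integral p \<Omega> f"
      using p_integral_ge_center[OF h(2)[OF f] p] h(3)[OF f] by simp
    moreover have "\<psi> 0 = z"
      using inv(1)[OF z] \<phi>(2) by simp
    ultimately have 1: "vol * (cmod (f z) powr p * (cmod (det (jac \<psi> 0)))\<^sup>2) \<le> p_integral p \<Omega> f"
      by (simp add: norm_mult powr_mult h(1)[OF zero_in])
    have "cmod (det (jac \<psi> 0)) * cmod (det (jac \<phi> z)) = 1"
      using J(1)[OF z] \<phi>(2) by (simp flip: norm_mult)
    then have 2: "(cmod (det (jac \<psi> 0)))\<^sup>2 * (cmod (det (jac \<phi> z)))\<^sup>2 = 1"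
      by (simp flip: power_mult_distrib)
    have "cmod (f z) powr p = ?K * (vol * (cmod (f z) powr p * (cmod (det (jac \<psi> 0)))\<^sup>2))"
      using 2 vol_pos by (simp add: algebra_simps)
    also have "\<dots> \<le> ?K * p_integral p \<Omega> f"
      using 1 vol_pos by (intro mult_left_mono) auto
    finally show ?thesis .
  qed
  obtain h where h: "\<And>w. w \<in> \<Omega> \<Longrightarrow> cmod (h w) powr p = (cmod (det (jac \<phi> w)))\<^sup>2"
    "\<And>f. f \<in> A_space p \<Omega> \<Longrightarrow> (\<lambda>w. f (\<phi> w) * h w) \<in> A_space p \<Omega>"
    "\<And>f. f \<in> A_space p \<Omega> \<Longrightarrow> p_integral p \<Omega> (\<lambda>w. f (\<phi> w) * h w) = p_integral p \<Omega> f"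
    using jacobian_weight[OF h\<phi> bij nz(1) p] by blast
  \<comment> \<open>The weight h is the pullback of the constant 1, for which the centre estimate is
    an equality.\<close>
  have ext: "h \<in> A_space p \<Omega>" "p_integral p \<Omega> h = vol" "cmod (h z) powr p = (cmod (det (jac \<phi> z)))\<^sup>2"
    using h(2,3)[OF const_A_space[OF p, of 1]] h(1)[OF z] p by (simp_all add: set_integral_const)
  have hz: "h z \<noteq> 0" "cmod (h z) powr p = ?K * p_integral p \<Omega> h"
    using ext nz[OF z] vol_pos by auto
  with ext show "\<exists>f\<in>A_space p \<Omega>. f z \<noteq> 0 \<and> cmod (f z) powr p = ?K * p_integral p \<Omega> f"
    by blast
  show "p_bergman_kernel p \<Omega> z = ?K"
    using vol_pos by (intro p_bergman_kernel_eqI[OF p z le _ ext(1) hz]) auto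
qed

text \<open>Composition with a rotation preserves A^p and its norm, so the same quotients occur at
  both points. The circle average in the Levi form thereby becomes a single value.\<close>

lemma p_bergman_kernel_rotate:
  assumes c: "cmod c = 1" and p: "p > 0"
  shows "p_bergman_kernel p \<Omega> (c *s z) = p_bergman_kernel p \<Omega> z"
proof -
  define K where "K z = {cmod (f z) powr p / p_norm p \<Omega> f powr p | f. f \<in> A_space p \<Omega> \<and> (\<exists>w\<in>\<Omega>. f w \<noteq> 0)}" for z
  have sub: "K (c *s z) \<subseteq> K z" if c: "cmod c = 1" for c z
  proof
    fix x assume "x \<in> K (c *s z)"
    then obtain f w where f: "f \<in> A_space p \<Omega>" "w \<in> \<Omega>" "f w \<noteq> 0" "x = cmod (f (c *s z)) powr p / p_norm p \<Omega> f powr p"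
      unfolding K_def by blast
    note hf = A_spaceD[OF f(1)]
    have c0: "c \<noteq> 0" using c by auto
    have cont: "continuous_on \<Omega> (\<lambda>w. cmod (f w) powr p)"
      using p by (rule powr_continuous_on[OF holo_on_imp_continuous_on[OF hf(1)]])
    have "(\<lambda>w. f (c *s w)) \<in> A_space p \<Omega>"
      unfolding A_space_def
      using holo_on_compose_map[OF holo_map_on_smult hf(1), of c \<Omega>] set_integral_rotate(1)[OF open_\<Omega> circular c cont] hf(2) c
        complete_circular_rotate_iff[OF circular c] by auto
    moreover have "p_norm p \<Omega> (\<lambda>w. f (c *s w)) = p_norm p \<Omega> f"
      unfolding p_norm_def using set_integral_rotate(2)[OF open_\<Omega> circular c cont] by simp
    moreover have "inverse c *s w \<in> \<Omega>"
      using f(2) c by (intro complete_circularD[OF circular]) (auto simp: norm_inverse)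
    moreover have "f (c *s (inverse c *s w)) \<noteq> 0"
      using f(3) c0 by simp
    ultimately have "\<exists>w\<in>\<Omega>. f (c *s w) \<noteq> 0" "(\<lambda>w. f (c *s w)) \<in> A_space p \<Omega>" "p_norm p \<Omega> (\<lambda>w. f (c *s w)) = p_norm p \<Omega> f"
      by blast+
    then show "x \<in> K z"
      unfolding K_def f(4) by (intro CollectI exI[of _ "\<lambda>w. f (c *s w)"]) auto
  qed
  have "c \<noteq> 0" using c by auto
  then have "K (c *s z) = K z"
    using sub[OF c, of z] sub[of "inverse c" "c *s z"] c by (auto simp: norm_inverse)
  then show ?thesis
    by (simp add: p_bergman_kernel_def K_def)
qed

section \<open>Two-sided bounds for the kernel with exponent 2 near the origin\<close>

lemma lin_mean_2: "(lin_mean 2 a)\<^sup>2 = p_integral 2 \<Omega> (lin_form a) / vol"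
proof -
  have "p_integral 2 \<Omega> (lin_form a) / vol \<ge> 0"
    using vol_pos p_integral_nonneg[of \<Omega> "lin_form a" 2] by simp
  then show ?thesis
    unfolding lin_mean_def by (simp only: powr_half_sqrt real_sqrt_pow2)
qed

text \<open>The test function is taken from the span of 1 and the form a: it is \<open>vol\<close>
  times the reproducing kernel of this plane at the point rX, which fixes the coefficient c and
  makes the integral of |f|^2 equal to \<open>vol\<close> times the value of f there.\<close>

lemma kernel_2_lower:
  assumes z: "of_real r *s X \<in> \<Omega>" and a: "a \<noteq> 0"
    and le: "\<And>f. f \<in> A_space 2 \<Omega> \<Longrightarrow> cmod (f (of_real r *s X)) powr 2 \<le> K * p_integral 2 \<Omega> f"
  shows "1 + r\<^sup>2 * (cmod (lin_form a X) / lin_mean 2 a)\<^sup>2 \<le> K * vol"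
proof -
  define N where "N = p_integral 2 \<Omega> (lin_form a)"
  have N: "N > 0" using p_integral_lin_form_pos[of 2 a] a by (simp add: N_def)
  define s where "s = lin_form a X"
  define c where "c = of_real (vol * r / N) * cnj s"
  define B where "B = (cmod s / lin_mean 2 a)\<^sup>2"
  have B: "B = (cmod s)\<^sup>2 * vol / N"
    unfolding B_def power_divide lin_mean_2 N_def by simp
  define f where "f z = 1 + lin_form (c *s a) z" for z
  have hol: "holo_on f \<Omega>"
    unfolding f_def by (intro holo_on_add holo_on_const holo_on_lin_form)
  have cont: "continuous_on \<Omega> (\<lambda>z. (cmod (f z))\<^sup>2)"
    by (intro continuous_intros holo_on_imp_continuous_on[OF hol])
  have li: "set_integrable lborel \<Omega> (\<lambda>z. (cmod (lin_form (c *s a) z))\<^sup>2)"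
    using A_spaceD(2)[OF lin_form_A_space[of 2 "c *s a"]] by simp
  have si: "set_integrable lborel \<Omega> (\<lambda>z. 2 + 2 * (cmod (lin_form (c *s a) z))\<^sup>2)"
    by (intro set_integral_add set_integrable_mult_right li set_integral_const)
  \<comment> \<open>Parallelogram law at z and -z: the cross term of 1 and the linear form cancels,
    and rotation by -1 gives both summands the same integral.\<close>
  have par: "(cmod (f z))\<^sup>2 + (cmod (f ((-1) *s z)))\<^sup>2 = 2 + 2 * (cmod (lin_form (c *s a) z))\<^sup>2" for z
    unfolding f_def lin_form_smult_right cmod_power2 by (simp add: power2_eq_square algebra_simps)
  have fi: "set_integrable lborel \<Omega> (\<lambda>z. (cmod (f z))\<^sup>2)"
  proof (rule set_integrable_bound[OF si])
    show "set_borel_measurable lborel \<Omega> (\<lambda>z. (cmod (f z))\<^sup>2)"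
      using set_borel_measurable_continuous_open[OF open_\<Omega> cont] by (simp add: set_borel_measurable_def)
    have "(cmod (f z))\<^sup>2 \<le> 2 + 2 * (cmod (lin_form (c *s a) z))\<^sup>2" for z
      using par[of z] zero_le_power2[of "cmod (f ((-1) *s z))"] by linarith
    then show "AE z in lborel. z \<in> \<Omega> \<longrightarrow> norm ((cmod (f z))\<^sup>2) \<le> norm (2 + 2 * (cmod (lin_form (c *s a) z))\<^sup>2)"
      by (auto intro: order_trans[OF _ abs_ge_self])
  qed
  have rot: "set_integrable lborel \<Omega> (\<lambda>z. (cmod (f ((-1) *s z)))\<^sup>2)"
    "(LINT z:\<Omega>|lborel. (cmod (f ((-1) *s z)))\<^sup>2) = (LINT z:\<Omega>|lborel. (cmod (f z))\<^sup>2)"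
    using set_integral_rotate[OF open_\<Omega> circular _ cont, of "-1"] fi by auto
  have "2 * (LINT z:\<Omega>|lborel. (cmod (f z))\<^sup>2) = (LINT z:\<Omega>|lborel. 2 + 2 * (cmod (lin_form (c *s a) z))\<^sup>2)"
    using set_integral_add(2)[OF fi rot(1), unfolded par] rot(2) by linarith
  also have "\<dots> = vol * 2 + 2 * ((cmod c)\<^sup>2 * N)"
    using set_integral_add(2)[OF set_integral_const(1)[of 2] set_integrable_mult_right[OF li, of 2]]
    by (simp add: set_integral_const lin_form_smult_left norm_mult power_mult_distrib N_def)
  finally have "p_integral 2 \<Omega> f = vol + (cmod c)\<^sup>2 * N"
    by simp
  also have "(cmod c)\<^sup>2 * N = vol * (r\<^sup>2 * B)"
    using N by (simp add: c_def B norm_mult power_mult_distrib norm_divide power_divide) (simp add: power2_eq_square)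
  finally have int: "p_integral 2 \<Omega> f = vol * (1 + r\<^sup>2 * B)"
    by (simp add: distrib_left)
  have "f (of_real r *s X) = 1 + of_real (r * (vol * r / N)) * (s * cnj s)"
    unfolding f_def lin_form_smult_left lin_form_smult_right s_def[symmetric] c_def by (simp add: algebra_simps)
  also have "\<dots> = of_real (1 + r\<^sup>2 * B)"
    unfolding complex_norm_square[symmetric] B by (simp add: power2_eq_square)
  finally have fz: "f (of_real r *s X) = of_real (1 + r\<^sup>2 * B)" .
  have pos: "1 + r\<^sup>2 * B > 0"
    by (simp add: B_def add_pos_nonneg)
  have "f \<in> A_space 2 \<Omega>"
    using hol fi by (simp add: A_space_def)
  from le[OF this] have "(1 + r\<^sup>2 * B)\<^sup>2 \<le> K * (vol * (1 + r\<^sup>2 * B))"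
    unfolding fz int by (simp add: power2_abs del: of_real_add of_real_mult)
  then have "1 + r\<^sup>2 * B \<le> K * vol"
    using pos by (simp add: power2_eq_square)
  then show ?thesis by (simp add: B_def s_def)
qed

text \<open>An extremal function is split into f(0), its linear part b and the remainder R. Each
  piece at rX is bounded by its own norm, and Cauchy-Schwarz combined with
  \<open>A2_remainder\<close> adds up the three constants.\<close>

lemma kernel_2_upper:
  assumes r: "r \<ge> 0" and a: "a \<noteq> 0"
    and max: "\<And>b. b \<noteq> 0 \<Longrightarrow> cmod (lin_form b X) / lin_mean 2 b \<le> cmod (lin_form a X) / lin_mean 2 a"
    and C: "C \<ge> 0" "\<And>R. R \<in> A_space 2 \<Omega> \<Longrightarrow> R 0 = 0 \<Longrightarrow> fderiv R 0 X = 0 \<Longrightarrow>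
      (cmod (R (of_real r *s X)))\<^sup>2 \<le> C * r ^ 4 * p_integral 2 \<Omega> R"
    and f: "f \<in> A_space 2 \<Omega>" "f (of_real r *s X) \<noteq> 0" "cmod (f (of_real r *s X)) powr 2 = K * p_integral 2 \<Omega> f"
  shows "K * vol \<le> 1 + r\<^sup>2 * (cmod (lin_form a X) / lin_mean 2 a)\<^sup>2 + vol * C * r ^ 4"
proof -
  note h = A_spaceD(1)[OF f(1)]
  define b where "b = (\<chi> j. fderiv f 0 (axis j 1))"
  have b: "fderiv f 0 = lin_form b"
    unfolding b_def by (rule fderiv_eq_lin_form[OF h zero_in])
  define R where "R = (\<lambda>z. f z - f 0 - fderiv f 0 z)"
  have R: "R \<in> A_space 2 \<Omega>" "vol * (cmod (f 0))\<^sup>2 + p_integral 2 \<Omega> (lin_form b) + p_integral 2 \<Omega> R \<le> p_integral 2 \<Omega> f"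
    using A2_remainder[OF f(1)] by (simp_all add: R_def b)
  have "(R has_derivative (\<lambda>v. lin_form b v - 0 - lin_form b v)) (at 0)"
    unfolding R_def b by (intro has_derivative_diff holo_on_has_derivative[OF h zero_in, unfolded b] has_derivative_const lin_form_has_derivative)
  then have R0: "R 0 = 0" "fderiv R 0 X = 0"
    using has_derivative_imp_fderiv[of R _ 0] by (auto simp: R_def b)
  define B where "B = (cmod (lin_form a X) / lin_mean 2 a)\<^sup>2"
  define N where "N = p_integral 2 \<Omega> (lin_form b)"
  define M where "M = p_integral 2 \<Omega> R"
  have N: "N \<ge> 0" and M: "M \<ge> 0"
    unfolding N_def M_def by (rule p_integral_nonneg)+
  \<comment> \<open>The maximality of a, squared, bounds the linear part of any f by its norm; the
    form b = 0 is treated apart.\<close>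
  have bX: "(cmod (lin_form b X))\<^sup>2 \<le> B / vol * N"
  proof (cases "b = 0")
    case False
    have Np: "N > 0" using p_integral_lin_form_pos[of 2 b] False by (simp add: N_def)
    have "(cmod (lin_form b X) / lin_mean 2 b)\<^sup>2 \<le> B"
      unfolding B_def using max[OF False] lin_mean_pos[of 2 b] False by (intro power_mono) auto
    then show ?thesis
      unfolding power_divide lin_mean_2 N_def[symmetric] using Np vol_pos by (simp add: field_simps)
  qed (use N vol_pos in \<open>simp add: B_def\<close>)
  define x where "x = cmod (f 0)" 
  define y where "y = r * cmod (lin_form b X)"
  define w where "w = cmod (R (of_real r *s X))"
  have wM: "w\<^sup>2 \<le> C * r ^ 4 * M"
    unfolding w_def M_def by (rule C(2)[OF R(1) R0])
  have yN: "y\<^sup>2 \<le> r\<^sup>2 * B / vol * N"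
    using mult_left_mono[OF bX, of "r\<^sup>2"] by (simp add: y_def power_mult_distrib)
  have "f (of_real r *s X) = f 0 + of_real r * lin_form b X + R (of_real r *s X)"
    by (simp add: R_def b lin_form_smult_right)
  then have "cmod (f (of_real r *s X)) \<le> x + y + w"
    unfolding x_def y_def w_def using r
    by (metis (no_types, lifting) abs_of_nonneg add_mono_thms_linordered_semiring(3) norm_mult norm_of_real norm_triangle_ineq order_trans)
  then have "(cmod (f (of_real r *s X)))\<^sup>2 \<le> (x + y + w)\<^sup>2"
    by (intro power_mono) auto
  also have "\<dots> \<le> (vol * x\<^sup>2 + N + M) * (1 / vol + r\<^sup>2 * B / vol + C * r ^ 4)"
  proof -
    define P where "P = r\<^sup>2 * B / vol"
    define Q where "Q = C * r ^ 4"
    have P: "P \<ge> 0" "Q \<ge> 0" using vol_pos C(1) by (simp_all add: P_def Q_def B_def)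
    have "\<bar>y\<bar> \<le> sqrt P * sqrt N"
      using real_sqrt_le_mono[OF yN[folded P_def]] by (simp add: real_sqrt_mult)
    moreover have "\<bar>w\<bar> \<le> sqrt Q * sqrt M"
      using real_sqrt_le_mono[OF wM] by (simp add: Q_def real_sqrt_mult)
    moreover have "x \<ge> 0" "y \<ge> 0" "w \<ge> 0" using r by (simp_all add: x_def y_def w_def)
    ultimately have "(x + y + w)\<^sup>2 \<le> (x + sqrt P * sqrt N + sqrt Q * sqrt M)\<^sup>2"
      by (intro power_mono) auto
    \<comment> \<open>The coefficient 1 of x is split so that the first component contributes
      \<open>vol\<close> times |f(0)|^2, as in \<open>A2_remainder\<close>.\<close>
    also have "(x + sqrt P * sqrt N + sqrt Q * sqrt M)\<^sup>2 = (sqrt (1 / vol) * (sqrt vol * x) + sqrt P * sqrt N + sqrt Q * sqrt M)\<^sup>2"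
      using vol_pos by (simp add: real_sqrt_divide)
    also have "\<dots> \<le> ((sqrt (1 / vol))\<^sup>2 + (sqrt P)\<^sup>2 + (sqrt Q)\<^sup>2) * ((sqrt vol * x)\<^sup>2 + (sqrt N)\<^sup>2 + (sqrt M)\<^sup>2)"
      by (rule cauchy_schwarz_3)
    also have "\<dots> = (vol * x\<^sup>2 + N + M) * (1 / vol + P + Q)"
      using vol_pos P N M by (simp add: power_mult_distrib mult.commute)
    finally show ?thesis by (simp add: P_def Q_def)
  qed
  also have "\<dots> \<le> p_integral 2 \<Omega> f * (1 / vol + r\<^sup>2 * B / vol + C * r ^ 4)"
    using R(2) vol_pos C(1) by (intro mult_right_mono) (auto simp: x_def N_def M_def B_def)
  finally have "K * p_integral 2 \<Omega> f \<le> (1 / vol + r\<^sup>2 * B / vol + C * r ^ 4) * p_integral 2 \<Omega> f"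
    using f(3) by (simp add: mult.commute)
  moreover have "p_integral 2 \<Omega> f > 0"
    using f(2,3) p_integral_nonneg[of \<Omega> f 2] by (cases "p_integral 2 \<Omega> f = 0") auto
  ultimately have "K \<le> 1 / vol + r\<^sup>2 * B / vol + C * r ^ 4"
    by simp
  then have "K * vol \<le> (1 / vol + r\<^sup>2 * B / vol + C * r ^ 4) * vol"
    using vol_pos by (intro mult_right_mono) auto
  also have "\<dots> = 1 + r\<^sup>2 * B + vol * C * r ^ 4"
    using vol_pos by (simp add: distrib_right)
  finally show ?thesis by (simp add: B_def)
qed

section \<open>The Levi form and the comparison of exponents\<close>

theorem levi_form_log_kernel:
  assumes hom: "homogeneous_dom \<Omega>" and p: "p > 0"
  shows "levi_form (\<lambda>z. ln (p_bergman_kernel p \<Omega> z)) 0 X = ereal ((p_bergman_metric 2 \<Omega> 0 X)\<^sup>2)"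
proof -
  obtain a where a: "a \<noteq> 0" "\<And>b. b \<noteq> 0 \<Longrightarrow> cmod (lin_form b X) / lin_mean 2 b \<le> cmod (lin_form a X) / lin_mean 2 a"
    using lin_ratio_attains[of 2 X] by auto
  define B where "B = (cmod (lin_form a X) / lin_mean 2 a)\<^sup>2"
  have B: "B \<ge> 0" "B = (p_bergman_metric 2 \<Omega> 0 X)\<^sup>2"
    using p_bergman_metric_zero[OF _ a] by (simp_all add: B_def)
  obtain C d where C: "C \<ge> 0" "d > 0" "\<And>l. cmod l \<le> d \<Longrightarrow> l *s X \<in> \<Omega>"
    "\<And>R r. R \<in> A_space 2 \<Omega> \<Longrightarrow> R 0 = 0 \<Longrightarrow> fderiv R 0 X = 0 \<Longrightarrow> 0 \<le> r \<Longrightarrow> r \<le> d \<Longrightarrow>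
      (cmod (R (of_real r *s X)))\<^sup>2 \<le> C * r ^ 4 * p_integral 2 \<Omega> R"
    using double_zero_bound[of X] by blast
  define k where "k r = p_bergman_kernel p \<Omega> (of_real r *s X) * vol" for r
  have k: "1 + r\<^sup>2 * B \<le> k r" "k r \<le> 1 + r\<^sup>2 * B + vol * C * r ^ 4" if r: "0 < r" "r \<le> d" for r
  proof -
    let ?z = "of_real r *s X"
    have z: "?z \<in> \<Omega>" using r by (intro C(3)) simp
    \<comment> \<open>One automorphism serves both exponents at this point, so \<open>k\<close>,
      which is built from K_p, obeys the bounds proved for exponent 2.\<close>
    obtain \<phi> where \<phi>: "biholo_aut \<Omega> \<phi>" "\<phi> ?z = 0"
      using hom z zero_in unfolding homogeneous_dom_def by blast
    note Kp = p_bergman_kernel_homogeneous(1)[OF \<phi> z p]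
    have two: "(0::real) < 2" by simp
    show "1 + r\<^sup>2 * B \<le> k r"
      unfolding k_def B_def Kp
      by (rule kernel_2_lower[OF z a(1) p_bergman_kernel_homogeneous(2)[OF \<phi> z two]])
    obtain f where f: "f \<in> A_space 2 \<Omega>" "f ?z \<noteq> 0" "cmod (f ?z) powr 2 = (cmod (det (jac \<phi> ?z)))\<^sup>2 / vol * p_integral 2 \<Omega> f"
      using p_bergman_kernel_homogeneous(3)[OF \<phi> z two] by blast
    show "k r \<le> 1 + r\<^sup>2 * B + vol * C * r ^ 4"
      unfolding k_def B_def Kp
      by (rule kernel_2_upper[OF _ a C(1) C(4) f]) (use r in auto)
  qed
  define L where "L = (\<lambda>r::real. 1 / r\<^sup>2 *
       (1 / (2 * pi) * (LBINT \<theta>:{0..2*pi}. ln (p_bergman_kernel p \<Omega> (0 + (of_real r * exp (\<i> * of_real \<theta>)) *s X)))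
        - ln (p_bergman_kernel p \<Omega> 0)))"
  have L: "L r = ln (k r) / r\<^sup>2" if r: "0 < r" "r \<le> d" for r
  proof -
    have "p_bergman_kernel p \<Omega> (0 + (of_real r * exp (\<i> * of_real \<theta>)) *s X) = p_bergman_kernel p \<Omega> (of_real r *s X)" for \<theta>
      using p_bergman_kernel_rotate[OF _ p, of "exp (\<i> * of_real \<theta>)" "of_real r *s X"]
      by (simp add: mult.commute)
    then have "L r = 1 / r\<^sup>2 * (ln (p_bergman_kernel p \<Omega> (of_real r *s X)) - ln (p_bergman_kernel p \<Omega> 0))"
      unfolding L_def by (simp add: set_lebesgue_integral_def)
    also have "ln (p_bergman_kernel p \<Omega> (of_real r *s X)) = ln (k r / vol)"
      using vol_pos by (simp add: k_def)
    also have "\<dots> = ln (k r) - ln vol"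
    proof -
      have "0 < 1 + r\<^sup>2 * B" using B(1) by (simp add: add_pos_nonneg)
      then have "k r > 0" using k(1)[OF r] by linarith
      then show ?thesis using vol_pos by (simp add: ln_div)
    qed
    finally show ?thesis
      using vol_pos by (simp add: p_bergman_kernel_zero[OF p] ln_div)
  qed
  have ev: "\<forall>\<^sub>F r in at_right 0. 0 < r \<and> r \<le> d"
    using eventually_at_right_real[OF C(2)] by eventually_elim auto
  have "(L \<longlongrightarrow> B) (at_right 0)"
  \<comment> \<open>The lower function comes from 1 - 1/x \<le> ln x at x = 1 + r^2 B, the upper one
    from ln x \<le> x - 1 at x = \<open>k r\<close>; both are divided by r^2.\<close>
  proof (rule tendsto_sandwich[where f = "\<lambda>r. B / (1 + r\<^sup>2 * B)" and h = "\<lambda>r. B + vol * C * r\<^sup>2"])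
    show "\<forall>\<^sub>F r in at_right 0. B / (1 + r\<^sup>2 * B) \<le> L r"
      using ev
    proof eventually_elim
      case (elim r)
      let ?x = "1 + r\<^sup>2 * B"
      have x: "?x > 0" using B(1) by (simp add: add_pos_nonneg)
      have "1 - 1 / ?x \<le> ln ?x"
        using ln_le_minus_one[of "1 / ?x"] x by (simp add: ln_div)
      also have "\<dots> \<le> ln (k r)"
        using k(1)[of r] elim x by (intro ln_mono) auto
      finally have "r\<^sup>2 * (B / ?x) \<le> ln (k r)"
        using x by (simp add: field_simps)
      then have "B / ?x \<le> ln (k r) / r\<^sup>2"
        using elim by (simp add: pos_le_divide_eq mult.commute)
      then show ?case using L elim by simp
    qed
    show "\<forall>\<^sub>F r in at_right 0. L r \<le> B + vol * C * r\<^sup>2"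
      using ev
    proof eventually_elim
      case (elim r)
      have "0 < 1 + r\<^sup>2 * B" using B(1) by (simp add: add_pos_nonneg)
      then have "ln (k r) \<le> k r - 1"
        using k(1)[of r] elim by (intro ln_le_minus_one) auto
      also have "\<dots> \<le> (B + vol * C * r\<^sup>2) * r\<^sup>2"
        using k(2)[of r] elim by (simp add: algebra_simps power2_eq_square power4_eq_xxxx)
      finally have "ln (k r) / r\<^sup>2 \<le> B + vol * C * r\<^sup>2"
        using elim by (simp add: pos_divide_le_eq)
      then show ?case using L elim by simp
    qed
    have "((\<lambda>r. B / (1 + r\<^sup>2 * B)) \<longlongrightarrow> B / (1 + 0\<^sup>2 * B)) (at_right 0)"
      by (intro tendsto_intros) auto
    then show "((\<lambda>r. B / (1 + r\<^sup>2 * B)) \<longlongrightarrow> B) (at_right 0)" by simp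
    have "((\<lambda>r. B + vol * C * r\<^sup>2) \<longlongrightarrow> B + vol * C * 0\<^sup>2) (at_right 0)"
      by (intro tendsto_intros)
    then show "((\<lambda>r. B + vol * C * r\<^sup>2) \<longlongrightarrow> B) (at_right 0)" by simp
  qed
  then have "((\<lambda>r. ereal (L r)) \<longlongrightarrow> ereal B) (at_right 0)"
    by simp
  then have "Liminf (at_right 0) (\<lambda>r. ereal (L r)) = ereal B"
    by (intro lim_imp_Liminf) auto
  then show ?thesis
    by (simp add: levi_form_def L_def B(2))
qed

end

theorem theorem1p1:
  fixes \<Omega> :: "(complex ^ 'n) set" and X :: "complex ^ 'n"
  assumes "bounded_domain \<Omega>" and "complete_circular \<Omega>" and "homogeneous_dom \<Omega>"
    and "X \<noteq> 0"
  shows "(\<forall>p::real. p > 2 \<longrightarrow>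
            levi_form (\<lambda>z. ln (p_bergman_kernel p \<Omega> z)) 0 X
              > ereal ((p_bergman_metric p \<Omega> 0 X)\<^sup>2)) \<and>
         (\<forall>p::real. 0 < p \<and> p < 2 \<longrightarrow>
            levi_form (\<lambda>z. ln (p_bergman_kernel p \<Omega> z)) 0 X
              < ereal ((p_bergman_metric p \<Omega> 0 X)\<^sup>2))"
proof -
  interpret circular_domain \<Omega>
    using assms by unfold_locales (auto simp: bounded_domain_def)
  have sq: "(p_bergman_metric q \<Omega> 0 X)\<^sup>2 < (p_bergman_metric p \<Omega> 0 X)\<^sup>2" if "0 < p" "p < q" for p q
    using p_bergman_metric_strict_antimono[OF that assms(4)] by (intro power_strict_mono) auto
  show ?thesis
    using sq[of 2] sq[of _ 2] by (auto simp: levi_form_log_kernel[OF assms(3)])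
qed

end
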